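(* Suppose that $0=\phi<\mu^{C}$ and that $\tau$ (for the process started from $(0,0)$) is subexponential. Then $$\frac{s_i(t-v)}{s_j(t)}\to1\ \text{ as } t\to\infty\quad\text{for all } v\ge0\text{ and all } i,j\in S,$$ (where $0\in S$ is identified with $(0,0)$), and, for all $v\ge 0$ and $u\in[0,1)$, $$\frac{s_{(0,u)}(t-v)}{s_{(0,0)}(t)}\to\frac{1-e^{-q_0(1-u)}}{1-e^{-q_0}}\ \text{ as } t\to\infty.$$
   Context: $X=(X_t)_{t\ge 0}$ is an irreducible, non-explosive, recurrent continuous-time Markov chain on $S=\mathbb Z^+=\{0,1,2,\dots\}$ or $S=\{0,\dots,K\}$, with distinguished state $0$; $C=S\setminus\{0\}$. Its $Q$-matrix is $(q_{i,j})$ and $q_i=-q_{i,i}$. $\tilde X$, the chain $X$ killed on first hitting $0$, is assumed irreducible on $C$. $\tau_0$ is the first hitting time of $0$ by $X$, and $$\mu^C=\inf\Big\{\lambda:\int_0^\infty\mathbb P_i(\tau_0>t)e^{\lambda t}dt=\infty\Big\},$$ which does not depend on $i\in C$. The current holding time $H_t$ is the time elapsed since the most recent entry of $X$ into $0$ if $X_t=0$, and $H_t=\emptyset$ if $X_t\ne0$. Let $\tau=\inf\{t: H_t\ge1\}$. Let $\hat S=C\cup(\{0\}\times[0,1))$; the state $(0,u)$ means that the chain is at $0$ with current holding time $u$. $\mathbb P_i$ is the law started from $i\in\hat S$ (starting from $(0,u)$ means that $X_0=0$ and the chain has already been at $0$ for time $u$). For $i\in\hat S$, $s_i(t)=\mathbb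 P_i(\tau>t)$. $H^1$ denotes a full holding time of $X$ in $0$ and $R^1$ the subsequent return time (from that departure from $0$ until the next return to $0$); $W=H^1+R^1$, $I(\lambda)=\mathbb E[e^{\lambda W}1_{(H^1<1)}]$, and $\phi=\sup\{\lambda\ge0: I(\lambda)\le1\}$. A random variable $Z\ge 0$ with distribution function $F_Z$ is subexponential if $\overline{F_Z^{n}}(t)/\overline{F_Z}(t)\to n$ as $t\to\infty$ for all $n$, where $F_Z^{n}$ is the $n$-fold convolution of $F_Z$ and $\overline G=1-G$. *)

theory Defs
  imports "HOL-Probability.Probability"
begin

text \<open>
  Sample paths are functions \<open>x :: real \<Rightarrow> nat\<close>, of which only the values at times \<open>t \<ge> 0\<close>
  matter. Random times take values in \<^typ>\<open>ereal\<close>, so that the infimum of an empty set of times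
  is \<open>\<infinity>\<close>.
\<close>

section \<open>Continuous-time Markov chains\<close>

primrec jump_time :: "(real \<Rightarrow> nat) \<Rightarrow> nat \<Rightarrow> ereal" where
  "jump_time x 0 = 0"
| "jump_time x (Suc n) =
     Inf {ereal t |t. jump_time x n \<le> ereal t \<and> x t \<noteq> x (real_of_ereal (jump_time x n))}"

text \<open>If the path has no further jump, the jump chain stays where it is.\<close>

primrec jump_chain :: "(real \<Rightarrow> nat) \<Rightarrow> nat \<Rightarrow> nat" where
  "jump_chain x 0 = x 0"
| "jump_chain x (Suc n) =
     (if jump_time x (Suc n) = \<infinity> then jump_chain x n
      else x (real_of_ereal (jump_time x (Suc n))))"

text \<open>
  In \<^typ>\<open>ereal\<close> the difference \<open>\<infinity> - \<infinity>\<close> is \<open>\<infinity>\<close>, which is the right holding time after absorption.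
\<close>

definition jump_hold :: "(real \<Rightarrow> nat) \<Rightarrow> nat \<Rightarrow> ereal" where
  "jump_hold x n = jump_time x (Suc n) - jump_time x n"

definition exit_rate :: "(nat \<Rightarrow> nat \<Rightarrow> real) \<Rightarrow> nat \<Rightarrow> real" where
  "exit_rate Q i = - Q i i"

definition jump_prob :: "(nat \<Rightarrow> nat \<Rightarrow> real) \<Rightarrow> nat \<Rightarrow> nat \<Rightarrow> real" where
  "jump_prob Q i j =
     (if exit_rate Q i = 0 then (if i = j then 1 else 0)
      else if i = j then 0 else Q i j / exit_rate Q i)"

definition Q_matrix :: "nat set \<Rightarrow> (nat \<Rightarrow> nat \<Rightarrow> real) \<Rightarrow> bool" where
  "Q_matrix S Q \<longleftrightarrow>
     (\<forall>i\<in>S. \<forall>j\<in>S. i \<noteq> j \<longrightarrow> 0 \<le> Q i j) \<and> (\<forall>i\<in>S. (Q i has_sum 0) S)"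

text \<open>
  \<open>P i\<close> is the law under which the right-continuous process \<open>X\<close> starts at \<open>i\<close>. The distribution is
  specified through the jump chain and the holding times: the jump chain is a discrete-time Markov
  chain with transition probabilities \<^const>\<open>jump_prob\<close> and, given the jump chain, the holding times
  are independent, the one in state \<open>k\<close> being exponential with rate \<open>exit_rate Q k\<close>. Explosion
  is not excluded here.
\<close>

locale ctmc =
  fixes S :: "nat set" and Q :: "nat \<Rightarrow> nat \<Rightarrow> real"
    and P :: "nat \<Rightarrow> 'w measure" and X :: "real \<Rightarrow> 'w \<Rightarrow> nat"
  assumes Q_matrix: "Q_matrix S Q"
    and prob_space_P: "\<And>i. i \<in> S \<Longrightarrow> prob_space (P i)"
    and measurable_X: "\<And>i t. i \<in> S \<Longrightarrow> 0 \<le> t \<Longrightarrow> X t \<in> measurable (P i) (count_space UNIV)"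
    and X_in_S: "\<And>i t \<omega>. i \<in> S \<Longrightarrow> 0 \<le> t \<Longrightarrow> \<omega> \<in> space (P i) \<Longrightarrow> X t \<omega> \<in> S"
    and right_continuous: "\<And>i t \<omega>. i \<in> S \<Longrightarrow> 0 \<le> t \<Longrightarrow> \<omega> \<in> space (P i) \<Longrightarrow>
      continuous (at_right t) (\<lambda>r. X r \<omega>)"
    and jump_law: "\<And>i n y t. i \<in> S \<Longrightarrow> (\<And>k. k \<le> n \<Longrightarrow> y k \<in> S) \<Longrightarrow>
      (\<And>k. k \<le> n \<Longrightarrow> 0 \<le> t k) \<Longrightarrow>
      measure (P i) {\<omega> \<in> space (P i). \<forall>k\<le>n.
          jump_chain (\<lambda>r. X r \<omega>) k = y k \<and> ereal (t k) < jump_hold (\<lambda>r. X r \<omega>) k} =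
        (if y 0 = i then 1 else 0) *
        (\<Prod>k<n. jump_prob Q (y k) (y (Suc k))) * (\<Prod>k\<le>n. exp (- exit_rate Q (y k) * t k))"

definition non_explosive ::
  "nat set \<Rightarrow> (nat \<Rightarrow> 'w measure) \<Rightarrow> (real \<Rightarrow> 'w \<Rightarrow> nat) \<Rightarrow> bool" where
  "non_explosive S P X \<longleftrightarrow>
     (\<forall>i\<in>S. AE \<omega> in P i. (SUP n. jump_time (\<lambda>r. X r \<omega>) n) = \<infinity>)"

definition irreducible_chain ::
  "nat set \<Rightarrow> (nat \<Rightarrow> 'w measure) \<Rightarrow> (real \<Rightarrow> 'w \<Rightarrow> nat) \<Rightarrow> bool" where
  "irreducible_chain S P X \<longleftrightarrow>
     (\<forall>i\<in>S. \<forall>j\<in>S. 0 < measure (P i) {\<omega> \<in> space (P i). \<exists>t\<ge>0. X t \<omega> = j})"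

definition recurrent_chain ::
  "nat set \<Rightarrow> (nat \<Rightarrow> 'w measure) \<Rightarrow> (real \<Rightarrow> 'w \<Rightarrow> nat) \<Rightarrow> bool" where
  "recurrent_chain S P X \<longleftrightarrow>
     (\<forall>i\<in>S. AE \<omega> in P i. \<not> bdd_above {t. 0 \<le> t \<and> X t \<omega> = i})"

section \<open>The chain killed at 0\<close>

definition tau0 :: "(real \<Rightarrow> nat) \<Rightarrow> ereal" where
  "tau0 x = Inf {ereal t |t. 0 \<le> t \<and> x t = 0}"

definition killed :: "(real \<Rightarrow> nat) \<Rightarrow> real \<Rightarrow> nat option" where
  "killed x t = (if ereal t < tau0 x then Some (x t) else None)"

definition killed_irreducible ::
  "nat set \<Rightarrow> (nat \<Rightarrow> 'w measure) \<Rightarrow> (real \<Rightarrow> 'w \<Rightarrow> nat) \<Rightarrow> bool" where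
  "killed_irreducible C P X \<longleftrightarrow>
     (\<forall>i\<in>C. \<forall>j\<in>C. 0 < measure (P i)
        {\<omega> \<in> space (P i). \<exists>t\<ge>0. killed (\<lambda>r. X r \<omega>) t = Some j})"

text \<open>
  The quantity \<open>\<mu>\<^sup>C\<close>, computed from the starting state \<open>i \<in> C\<close>; when the killed chain is irreducible
  on \<open>C\<close> it does not depend on \<open>i\<close>.
\<close>

definition mu_C :: "(nat \<Rightarrow> 'w measure) \<Rightarrow> (real \<Rightarrow> 'w \<Rightarrow> nat) \<Rightarrow> nat \<Rightarrow> ereal" where
  "mu_C P X i = Inf {ereal l |l.
     (\<integral>\<^sup>+t\<in>{0..}. ennreal
        (measure (P i) {\<omega> \<in> space (P i). ereal t < tau0 (\<lambda>r. X r \<omega>)} * exp (l * t)) \<partial>lborel) = \<infinity>}"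

section \<open>Waiting at 0\<close>

text \<open>
  \<open>holding u x t\<close> is the current holding time \<open>H\<^sub>t\<close> of the path \<open>x\<close>, \<^const>\<open>None\<close> standing for
  \<open>\<emptyset>\<close>. If the path starts in 0, then \<open>u\<close> is the time already spent there before time 0.
\<close>

definition holding :: "real \<Rightarrow> (real \<Rightarrow> nat) \<Rightarrow> real \<Rightarrow> real option" where
  "holding u x t =
     (if x t \<noteq> 0 then None
      else if \<forall>s\<in>{0..t}. x s = 0 then Some (u + t)
      else Some (t - Inf {r \<in> {0..t}. \<forall>s\<in>{r..t}. x s = 0}))"

definition tau :: "real \<Rightarrow> (real \<Rightarrow> nat) \<Rightarrow> ereal" where
  "tau u x = Inf {ereal t |t. 0 \<le> t \<and> (\<exists>h. holding u x t = Some h \<and> 1 \<le> h)}"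

text \<open>
  The extended state space: \<open>Away i\<close> stands for \<open>i \<in> C\<close> and \<open>AtZero u\<close> for the state \<open>(0, u)\<close>.
  Starting from \<open>(0, u)\<close>, the process \<open>X\<close> itself has law \<open>P 0\<close>; the age \<open>u\<close> enters only
  through the current holding time.
\<close>

datatype hstate = Away nat | AtZero real

primrec law :: "(nat \<Rightarrow> 'w measure) \<Rightarrow> hstate \<Rightarrow> 'w measure" where
  "law P (Away i) = P i"
| "law P (AtZero u) = P 0"

primrec age :: "hstate \<Rightarrow> real" where
  "age (Away i) = 0"
| "age (AtZero u) = u"

definition hat :: "nat \<Rightarrow> hstate" where
  "hat i = (if i = 0 then AtZero 0 else Away i)"

definition surv ::
  "(nat \<Rightarrow> 'w measure) \<Rightarrow> (real \<Rightarrow> 'w \<Rightarrow> nat) \<Rightarrow> hstate \<Rightarrow> real \<Rightarrow> real" where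
  "surv P X z t =
     measure (law P z) {\<omega> \<in> space (law P z). ereal t < tau (age z) (\<lambda>r. X r \<omega>)}"

text \<open>
  For a path started in 0: the first holding time \<open>H\<^sup>1\<close> in 0, the subsequent return
  time \<open>R\<^sup>1\<close>, and \<open>W = H\<^sup>1 + R\<^sup>1\<close>. Under \<open>P 0\<close> they are almost surely finite in a recurrent
  irreducible chain with at least two states, so the value of \<^const>\<open>real_of_ereal\<close> at \<open>\<infinity>\<close>
  is irrelevant.
\<close>

definition H1 :: "(real \<Rightarrow> nat) \<Rightarrow> ereal" where
  "H1 x = Inf {ereal t |t. 0 \<le> t \<and> x t \<noteq> 0}"

definition R1 :: "(real \<Rightarrow> nat) \<Rightarrow> ereal" where
  "R1 x = Inf {ereal t |t. 0 \<le> t \<and> x (real_of_ereal (H1 x) + t) = 0}"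

definition W :: "(real \<Rightarrow> nat) \<Rightarrow> ereal" where
  "W x = H1 x + R1 x"

definition I_fun :: "(nat \<Rightarrow> 'w measure) \<Rightarrow> (real \<Rightarrow> 'w \<Rightarrow> nat) \<Rightarrow> real \<Rightarrow> ennreal" where
  "I_fun P X l = (\<integral>\<^sup>+\<omega>. ennreal (exp (l * real_of_ereal (W (\<lambda>r. X r \<omega>)))) *
     indicator {\<omega>. H1 (\<lambda>r. X r \<omega>) < 1} \<omega> \<partial>P 0)"

definition phi :: "(nat \<Rightarrow> 'w measure) \<Rightarrow> (real \<Rightarrow> 'w \<Rightarrow> nat) \<Rightarrow> ereal" where
  "phi P X = Sup {ereal l |l. 0 \<le> l \<and> I_fun P X l \<le> 1}"

section \<open>Subexponential random variables\<close>

primrec conv_power :: "real measure \<Rightarrow> nat \<Rightarrow> real measure" where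
  "conv_power D 0 = return borel 0"
| "conv_power D (Suc n) = convolution D (conv_power D n)"

text \<open>
  The case \<open>n = 1\<close> forces the denominator to be eventually nonzero, as \<open>x / 0 = 0\<close>.
\<close>

definition subexponential :: "'w measure \<Rightarrow> ('w \<Rightarrow> real) \<Rightarrow> bool" where
  "subexponential M Z \<longleftrightarrow>
     Z \<in> borel_measurable M \<and> (AE \<omega> in M. 0 \<le> Z \<omega>) \<and>
     (\<forall>n\<ge>1. ((\<lambda>t. (1 - cdf (conv_power (distr M borel Z) n) t) / (1 - cdf (distr M borel Z) t))
        \<longlongrightarrow> real n) at_top)"

end

theory Submission
  imports Defs
begin

text \<open>
  A path is determined by its jump chain and its holding times, and after any jump this sequence
  starts afresh. Write \<open>F\<close> for the tail of \<open>\<tau>\<close> started from \<open>(0, 0)\<close>. Subexponentiality is only used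
  in that \<open>F\<close> is long-tailed, \<open>F (t - v) / F t \<rightarrow> 1\<close>.

  From \<open>j \<in> C\<close> the chain first waits until \<open>\<tau>\<^sub>0\<close> and then \<open>\<tau>\<close> starts afresh from \<open>(0, 0)\<close>, so
  \<open>s\<^sub>j t = E\<^sub>j (F (t - \<tau>\<^sub>0))\<close>. As \<open>\<mu>\<^sup>C > 0\<close>, the time \<open>\<tau>\<^sub>0\<close> has an exponential moment, while a long tail
  satisfies \<open>F (t - y) \<le> B e\<^bsup>\<epsilon>y\<^esup> F t\<close> for all \<open>y \<ge> 0\<close> and large \<open>t\<close>; dominated convergence gives
  \<open>s\<^sub>j t / F t \<rightarrow> 1\<close>.

  From \<open>(0, u)\<close> the chain survives beyond age 1 only if it leaves 0 within time \<open>1 - u\<close>, which has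
  probability \<open>c\<^sub>u = 1 - e\<^bsup>-q\<^sub>0(1-u)\<^esup>\<close>. With \<open>G\<close> the tail of \<open>\<tau>\<close> counted from the first jump out of 0,
  monotonicity yields \<open>c\<^sub>u G t \<le> s\<^sub>u t \<le> c\<^sub>u G (t - 1 + u)\<close>. The case \<open>u = 0\<close> compares \<open>G\<close> with \<open>F\<close>, and the
  ratio \<open>c\<^sub>u / c\<^sub>0\<close> follows since \<open>F\<close> is long-tailed.
\<close>

section \<open>Sample paths and their jumps\<close>

text \<open>The law is given only through joint probabilities of finitely many states and holding
  times of the jump chain; no Markov property is available on paths. Hence path functionals are
  first rewritten as functionals of the sequence \<open>jseq\<close>, whose law is pinned down by
  the sets \<open>cyl\<close>, a generating pi-system. On sequences the first holding time splits
  off as an independent factor, and induction on the number of jumps gives the Markov property at a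
  fixed index. A strong Markov property at the first visit to 0 is replaced by a sum over the index
  of that visit. Two mismatches remain. The rate mu^C is computed from one state k, while the
  exponential moment is needed from every j; a passage from k to j that avoids 0 transfers it. And
  subexponentiality concerns a real-valued version of tau, while survival is about tau in
  \<open>ereal\<close>.\<close>

declare jump_time.simps(2) [simp del]

definition rc_path :: "(real \<Rightarrow> nat) \<Rightarrow> bool" where
  "rc_path x \<longleftrightarrow> (\<forall>t\<ge>0. continuous (at_right t) x)"

text \<open>Singletons are open in the discrete state space, so a right limit is a value that is
  attained on a whole interval.\<close>

lemma rc_pathE:
  assumes "rc_path x" "0 \<le> t"
  obtains b where "t < b" "\<forall>r\<in>{t<..<b}. x r = x t"
proof -
  have "(x \<longlongrightarrow> x t) (at_right t)"
    using assms by (simp add: rc_path_def continuous_within)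
  hence "\<forall>\<^sub>F r in at_right t. x r \<in> {x t}"
    by (rule topological_tendstoD) (simp_all add: discrete_topology_class.open_discrete)
  then obtain b where "b > t" "\<forall>r>t. r < b \<longrightarrow> x r = x t"
    by (auto simp: eventually_at_right_field)
  thus ?thesis
    by (intro that[of b]) (auto simp: order_le_less)
qed

text \<open>This replaces quantifiers over real times by countable ones in all measurability proofs
  below.\<close>

lemma rc_path_rat:
  assumes "rc_path x" "0 \<le> t" "t < c"
  obtains q :: rat where "t < of_rat q" "of_rat q < c" "x (of_rat q) = x t"
proof -
  obtain b where b: "t < b" "\<forall>r\<in>{t<..<b}. x r = x t"
    using rc_pathE[OF assms(1,2)] .
  obtain q where "t < of_rat q" "of_rat q < min b c"
    using of_rat_dense[of t "min b c"] b assms by auto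
  with b show ?thesis by (intro that[of q]) auto
qed

lemma jump_time_nonneg: "0 \<le> jump_time x n"
proof (induction n)
  case (Suc n)
  show ?case unfolding jump_time.simps
    by (rule Inf_greatest) (use Suc in \<open>auto intro: order_trans\<close>)
qed simp

lemma jump_time_le_Suc: "jump_time x n \<le> jump_time x (Suc n)"
  unfolding jump_time.simps by (auto intro!: Inf_greatest)

lemma jump_time_neq_MInf [simp]: "jump_time x n \<noteq> -\<infinity>"
  using jump_time_nonneg[of x n] by auto

definition jseq :: "(real \<Rightarrow> nat) \<Rightarrow> nat \<Rightarrow> nat \<times> real" where
  "jseq x n = (jump_chain x n, real_of_ereal (jump_hold x n))"

definition tsum :: "(nat \<Rightarrow> nat \<times> real) \<Rightarrow> nat \<Rightarrow> real" where
  "tsum s n = (\<Sum>k<n. snd (s k))"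

lemma tsum_0 [simp]: "tsum s 0 = 0"
  by (simp add: tsum_def)

lemma jump_hold_pos:
  assumes "rc_path x"
  shows "0 < jump_hold x n"
proof (cases "jump_time x n")
  case (real t)
  have t: "0 \<le> t" using jump_time_nonneg[of x n] real by simp
  obtain b where b: "t < b" "\<forall>r\<in>{t<..<b}. x r = x t"
    using rc_pathE[OF assms t] .
  have "ereal b \<le> jump_time x (Suc n)"
    unfolding jump_time.simps
  proof (rule Inf_greatest, safe)
    fix r assume "jump_time x n \<le> ereal r" "x r \<noteq> x (real_of_ereal (jump_time x n))"
    hence "t \<le> r" "x r \<noteq> x t" using real by auto
    hence "\<not> r < b" using b(2) by (metis greaterThanLessThan_iff order_le_less)
    thus "ereal b \<le> ereal r" by simp
  qed
  hence "ereal t < jump_time x (Suc n)" using b(1) by (meson ereal_less_eq(3) less_ereal.simps(1) order_less_le_trans)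
  thus ?thesis using real by (cases "jump_time x (Suc n)") (auto simp: jump_hold_def)
next
  case PInf
  thus ?thesis using jump_time_le_Suc[of x n] by (auto simp: jump_hold_def)
qed auto

text \<open>The event, almost sure by \<open>good_AE\<close>, on which \<open>real_of_ereal\<close>
  in \<open>jseq\<close> loses nothing and the holding intervals cover all of [0,
  \<infinity>).\<close>

definition good_path :: "(real \<Rightarrow> nat) \<Rightarrow> bool" where
  "good_path x \<longleftrightarrow> rc_path x \<and> (\<forall>n. jump_time x n \<noteq> \<infinity>) \<and> (SUP n. jump_time x n) = \<infinity>"

context
  fixes x :: "real \<Rightarrow> nat"
  assumes good: "good_path x"
begin

lemma good_rc: "rc_path x"
  using good by (simp add: good_path_def)

lemma jump_time_eq_tsum: "jump_time x n = ereal (tsum (jseq x) n)"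
proof (induction n)
  case (Suc n)
  have "jump_time x (Suc n) \<noteq> \<infinity>" using good unfolding good_path_def by blast
  then obtain r where "jump_time x (Suc n) = ereal r"
    by (cases "jump_time x (Suc n)") (auto)
  thus ?case using Suc
    by (simp add: tsum_def jseq_def jump_hold_def)
qed (simp add: tsum_def)

lemma jump_hold_eq: "jump_hold x n = ereal (snd (jseq x n))"
  using jump_time_eq_tsum[of n] jump_time_eq_tsum[of "Suc n"]
  by (simp add: jump_hold_def jseq_def)

lemma jseq_hold_pos: "0 < snd (jseq x n)"
  using jump_hold_pos[OF good_rc, of n] by (simp add: jump_hold_eq)

lemma fst_jseq: "fst (jseq x n) = x (tsum (jseq x) n)"
  using jump_time_eq_tsum[of n]
  by (cases n) (auto simp: jseq_def tsum_def)

lemma tsum_jseq_nonneg: "0 \<le> tsum (jseq x) n"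
  using jump_time_nonneg[of x n] by (simp add: jump_time_eq_tsum)

lemma path_between_jumps:
  assumes "tsum (jseq x) n \<le> t" "t < tsum (jseq x) (Suc n)"
  shows "x t = fst (jseq x n)"
proof (rule ccontr)
  assume "\<not> ?thesis"
  hence "jump_time x (Suc n) \<le> ereal t"
    unfolding jump_time.simps using assms(1) by (auto intro!: Inf_lower simp: jump_time_eq_tsum fst_jseq)
  thus False using assms(2) by (simp add: jump_time_eq_tsum)
qed

text \<open>If the jump led back to the same state, right continuity would keep the path there for a
  while longer, and the jump time could not be the infimum of the times of change. Consequently a
  stay at 0 starts exactly at a jump and is not prolonged by the next one.\<close>

lemma jseq_neq_Suc: "fst (jseq x (Suc n)) \<noteq> fst (jseq x n)"
proof
  assume eq: "fst (jseq x (Suc n)) = fst (jseq x n)"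
  let ?T = "tsum (jseq x)"
  obtain b where b: "?T (Suc n) < b" "\<forall>r\<in>{?T (Suc n)<..<b}. x r = x (?T (Suc n))"
    using rc_pathE[OF good_rc tsum_jseq_nonneg, of "Suc n"] .
  have "ereal b \<le> jump_time x (Suc n)"
    unfolding jump_time.simps
  proof (safe intro!: Inf_greatest)
    fix t assume t: "jump_time x n \<le> ereal t" "x t \<noteq> x (real_of_ereal (jump_time x n))"
    show "ereal b \<le> ereal t"
    proof (rule ccontr)
      assume "\<not> ereal b \<le> ereal t"
      hence "t < b" by simp
      moreover have "?T n \<le> t" using t by (simp add: jump_time_eq_tsum)
      ultimately have "x t = fst (jseq x n)"
        using path_between_jumps[of n t] b(2) eq fst_jseq[of "Suc n"]
        by (metis greaterThanLessThan_iff not_less order_le_less)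
      thus False using t by (simp add: jump_time_eq_tsum fst_jseq)
    qed
  qed
  thus False using b(1) by (simp add: jump_time_eq_tsum)
qed

lemma ex_jump_interval:
  assumes "0 \<le> t"
  obtains n where "tsum (jseq x) n \<le> t" "t < tsum (jseq x) (Suc n)"
proof -
  have "ereal t < (SUP n. jump_time x n)" using good by (simp add: good_path_def)
  then obtain m where "ereal t < jump_time x m" by (auto simp: less_SUP_iff)
  hence ex: "\<exists>m. t < tsum (jseq x) m" by (auto simp: jump_time_eq_tsum)
  define m where "m = (LEAST m. t < tsum (jseq x) m)"
  have m: "t < tsum (jseq x) m" unfolding m_def using ex by (rule LeastI_ex)
  have "m \<noteq> 0" using m assms by (auto simp: tsum_def intro!: Nat.gr0I)
  then obtain n where n: "m = Suc n" by (cases m) auto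
  have "\<not> t < tsum (jseq x) n" using not_less_Least[of n "\<lambda>m. t < tsum (jseq x) m"] n
    by (simp add: m_def)
  with m n show ?thesis by (intro that[of n]) auto
qed

lemma tsum_jseq_mono: "m \<le> n \<Longrightarrow> tsum (jseq x) m \<le> tsum (jseq x) n"
  unfolding tsum_def by (intro sum_mono2) (auto intro: less_imp_le jseq_hold_pos)

lemma fst_jseq_0: "fst (jseq x 0) = x 0"
  by (simp add: jseq_def)

end

section \<open>The times \<open>tau\<close> and \<open>tau0\<close> as functionals of the jump
  sequence\<close>

text \<open>This removes the infimum from \<open>holding\<close>. Two alternatives remain because
  the age \<open>u\<close> counts only while the path has not yet left 0.\<close>

lemma holding_ge_1_iff:
  assumes "rc_path x" "0 \<le> t" 
  shows "(\<exists>h. holding u x t = Some h \<and> 1 \<le> h) \<longleftrightarrow>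
    (\<forall>r\<in>{0..t}. x r = 0) \<and> 1 \<le> u + t \<or> (\<exists>r\<in>{0..t}. x r \<noteq> 0) \<and> 1 \<le> t \<and> (\<forall>r\<in>{t-1..t}. x r = 0)"
proof (cases "x t = 0 \<and> (\<exists>r\<in>{0..t}. x r \<noteq> 0)")
  case True
  then obtain r0 where r0: "0 \<le> r0" "r0 \<le> t" "x r0 \<noteq> 0" by auto
  define A where "A = {r \<in> {0..t}. \<forall>s\<in>{r..t}. x s = 0}"
  have tA: "t \<in> A" using True assms by (auto simp: A_def)
  have bdd: "bdd_below A" by (auto simp: A_def intro!: bdd_belowI[of _ 0])
  have hold: "holding u x t = Some (t - Inf A)" using True by (auto simp: holding_def A_def)
  have "1 \<le> t - Inf A \<longleftrightarrow> 1 \<le> t \<and> (\<forall>r\<in>{t-1..t}. x r = 0)"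
  proof
    assume le: "1 \<le> t - Inf A"
    have "0 \<le> Inf A" using tA by (intro cInf_greatest) (auto simp: A_def)
    hence "1 \<le> t" using le by simp
    have op: "x r = 0" if "t - 1 < r" "r \<le> t" for r
    proof -
      have "Inf A < r" using le that by simp
      then obtain a where "a \<in> A" "a < r" using tA bdd by (subst (asm) cInf_less_iff) auto
      thus ?thesis using that by (auto simp: A_def)
    qed
    \<comment> \<open>The infimum of \<open>A\<close> only controls times strictly after t - 1;
      right continuity at t - 1 carries the value 0 to the left end point.\<close>
    obtain b where b: "t - 1 < b" "\<forall>r\<in>{t-1<..<b}. x r = x (t - 1)"
      using rc_pathE[OF assms(1), of "t - 1"] \<open>1 \<le> t\<close> by auto
    define r where "r = (t - 1 + min b t) / 2"
    have "t - 1 < r" "r < b" "r \<le> t" using b(1) by (auto simp: r_def min_def)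
    hence "x (t - 1) = 0" using op[of r] b(2) by simp
    thus "1 \<le> t \<and> (\<forall>r\<in>{t-1..t}. x r = 0)" using op \<open>1 \<le> t\<close> by (metis atLeastAtMost_iff order_le_less)
  next
    assume "1 \<le> t \<and> (\<forall>r\<in>{t-1..t}. x r = 0)"
    hence "t - 1 \<in> A" by (auto simp: A_def)
    hence "Inf A \<le> t - 1" using bdd by (rule cInf_lower)
    thus "1 \<le> t - Inf A" by simp
  qed
  thus ?thesis using hold True by auto
next
  case False
  thus ?thesis using assms by (auto simp: holding_def)
qed

lemma tau_eq_Inf:
  assumes "rc_path x" "0 \<le> u"
  shows "tau u x = Inf {ereal t |t. 0 \<le> t \<and>
    ((\<forall>r\<in>{0..t}. x r = 0) \<and> 1 \<le> u + t \<or> 1 \<le> t \<and> (\<forall>r\<in>{t-1..t}. x r = 0))}"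
proof -
  have "(\<exists>h. holding u x t = Some h \<and> 1 \<le> h) \<longleftrightarrow>
    (\<forall>r\<in>{0..t}. x r = 0) \<and> 1 \<le> u + t \<or> 1 \<le> t \<and> (\<forall>r\<in>{t-1..t}. x r = 0)" if "0 \<le> t" for t
    using holding_ge_1_iff[OF assms(1) that, of u] that assms by auto
  thus ?thesis unfolding tau_def by (intro arg_cong[of _ _ Inf]) auto
qed

text \<open>The value of tau at age 0: one time unit after the start of the first long stay at 0.
  The bound on the holding time is strict because after a stay of length exactly 1 the path has left
  0 at the moment when the age would reach 1.\<close>

definition ftau :: "(nat \<Rightarrow> nat \<times> real) \<Rightarrow> ereal" where
  "ftau s = (INF n\<in>{n. fst (s n) = 0 \<and> 1 < snd (s n)}. ereal (tsum s n + 1))"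

definition ftau0 :: "(nat \<Rightarrow> nat \<times> real) \<Rightarrow> ereal" where
  "ftau0 s = (INF n\<in>{n. fst (s n) = 0}. ereal (tsum s n))"

lemma tsum_Suc_shift: "tsum s (Suc n) = snd (s 0) + tsum (\<lambda>n. s (Suc n)) n"
  unfolding tsum_def by (rule sum.lessThan_Suc_shift)

lemma tau0_eq_ftau0:
  assumes "good_path x"
  shows "tau0 x = ftau0 (jseq x)"
proof (rule antisym)
  show "tau0 x \<le> ftau0 (jseq x)"
    unfolding ftau0_def
  proof (rule INF_greatest)
    fix n assume "n \<in> {n. fst (jseq x n) = 0}"
    hence "x (tsum (jseq x) n) = 0" by (simp add: fst_jseq[OF assms, symmetric])
    thus "tau0 x \<le> ereal (tsum (jseq x) n)"
      unfolding tau0_def using tsum_jseq_nonneg[OF assms] by (intro Inf_lower) auto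
  qed
  show "ftau0 (jseq x) \<le> tau0 x"
    unfolding tau0_def
  proof (safe intro!: Inf_greatest)
    fix t assume t: "0 \<le> t" "x t = 0"
    obtain n where n: "tsum (jseq x) n \<le> t" "t < tsum (jseq x) (Suc n)"
      using ex_jump_interval[OF assms t(1)] .
    have "fst (jseq x n) = 0" using path_between_jumps[OF assms n] t by simp
    hence "ftau0 (jseq x) \<le> ereal (tsum (jseq x) n)" unfolding ftau0_def by (intro INF_lower) simp
    also have "\<dots> \<le> ereal t" using n by simp
    finally show "ftau0 (jseq x) \<le> ereal t" .
  qed
qed

text \<open>The age \<open>u\<close> shortens the required stay only for a stay that begins at time
  0, so index 0 is treated apart and every later stay must exceed 1.\<close>

lemma tau_eq_jump_Inf:
  assumes x: "good_path x" and u: "0 \<le> u" "u < 1"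
  shows "tau u x = (if x 0 = 0 \<and> 1 - u < snd (jseq x 0) then ereal (1 - u)
    else (INF n\<in>{n. 0 < n \<and> fst (jseq x n) = 0 \<and> 1 < snd (jseq x n)}. ereal (tsum (jseq x) n + 1)))"
    (is "_ = ?R")
proof -
  let ?s = "jseq x" and ?T = "tsum (jseq x)"
  let ?A = "\<lambda>t. (\<forall>r\<in>{0..t}. x r = 0) \<and> 1 \<le> u + t \<or> 1 \<le> t \<and> (\<forall>r\<in>{t-1..t}. x r = 0)"
  have tau: "tau u x = Inf {ereal t |t. 0 \<le> t \<and> ?A t}"
    by (rule tau_eq_Inf) (use x u in \<open>auto simp: good_path_def\<close>)
  have "?R \<le> ereal t" if t: "0 \<le> t" "?A t" for t
  proof -
    obtain n where n: "?T n \<le> t" "t < ?T (Suc n)"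
      using ex_jump_interval[OF x t(1)] .
    have "x t = 0" using t by auto
    hence y0: "fst (?s n) = 0" using path_between_jumps[OF x n] by simp
    show ?thesis
    proof (cases n)
      case 0
      hence "t < snd (?s 0)" using n by (simp add: tsum_def)
      moreover have "1 \<le> u + t" using t u by auto
      ultimately show ?thesis using y0 0 by (simp add: fst_jseq_0[OF x])
    next
      case (Suc m)
      \<comment> \<open>A jump changes the state, so the stay at 0 containing t begins at
        \<open>?T n\<close> and not earlier.\<close>
      have neq: "fst (?s m) \<noteq> 0" using jseq_neq_Suc[OF x, of m] y0 Suc by simp
      have nz: "x r \<noteq> 0" if "?T m \<le> r" "r < ?T n" for r
        using path_between_jumps[OF x, of m r] neq that Suc by simp
      have mn: "?T m < ?T n" using jseq_hold_pos[OF x, of m] Suc by (simp add: tsum_def)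
      have m0: "0 \<le> ?T m" by (rule tsum_jseq_nonneg[OF x])
      have "\<not> (\<forall>r\<in>{0..t}. x r = 0)" using nz[of "?T m"] mn m0 n by auto
      hence t1: "1 \<le> t" "\<forall>r\<in>{t-1..t}. x r = 0" using t by auto
      have "?T n \<le> t - 1"
      proof (rule ccontr)
        assume "\<not> ?thesis"
        \<comment> \<open>This time lies both in the holding interval of the preceding nonzero state
          and in [t - 1, t].\<close>
        hence "x (max (?T m) (t - 1)) \<noteq> 0" using nz mn by auto
        thus False using t1 n mn by auto
      qed
      moreover have "1 < snd (?s n)" using n calculation by (simp add: tsum_def)
      ultimately have "(INF n\<in>{n. 0 < n \<and> fst (?s n) = 0 \<and> 1 < snd (?s n)}. ereal (?T n + 1)) \<le> ereal t"
        using y0 Suc by (intro INF_lower2[of n]) auto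
      thus ?thesis using t1 u by auto
    qed
  qed
  hence "?R \<le> tau u x" unfolding tau by (intro Inf_greatest) auto
  moreover have "tau u x \<le> ereal (1 - u)" if "x 0 = 0" "1 - u < snd (?s 0)"
    unfolding tau
  proof (intro Inf_lower CollectI exI conjI disjI1 ballI refl)
    fix r assume "r \<in> {0..1-u}"
    thus "x r = 0" using path_between_jumps[OF x, of 0 r] that by (auto simp: tsum_def fst_jseq_0[OF x])
  qed (use u in auto)
  moreover have "tau u x \<le> ereal (?T n + 1)" if "fst (?s n) = 0" "1 < snd (?s n)" for n
    unfolding tau
  proof (intro Inf_lower CollectI exI conjI disjI2 ballI refl)
    fix r assume "r \<in> {?T n + 1 - 1..?T n + 1}"
    thus "x r = 0" using path_between_jumps[OF x, of n r] that by (auto simp: tsum_def)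
  qed (use tsum_jseq_nonneg[OF x, of n] in auto)
  ultimately show ?thesis by (auto intro!: antisym INF_greatest)
qed

lemma INF_ereal_add_real:
  fixes f :: "'a \<Rightarrow> ereal"
  shows "(INF i\<in>I. ereal c + f i) = ereal c + (INF i\<in>I. f i)"
proof (rule antisym)
  have "(INF i\<in>I. ereal c + f i) - ereal c \<le> (INF i\<in>I. f i)"
    by (intro INF_greatest)
      (auto simp: ereal_minus_le add.commute[of _ "ereal c"] intro: INF_lower[of _ _ "\<lambda>i. ereal c + f i"])
  thus "(INF i\<in>I. ereal c + f i) \<le> ereal c + (INF i\<in>I. f i)"
    by (simp add: ereal_minus_le add.commute)
qed (intro INF_greatest add_left_mono INF_lower)

lemma Inf_jumps_shift:
  "(INF n\<in>{n. 0 < n \<and> fst (s n) = 0 \<and> 1 < snd (s n)}. ereal (tsum s n + 1)) =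
   ereal (snd (s 0)) + ftau (\<lambda>n. s (Suc n))"
proof -
  let ?s = "\<lambda>n. s (Suc n)"
  have "{n. 0 < n \<and> fst (s n) = 0 \<and> 1 < snd (s n)} = Suc ` {n. fst (?s n) = 0 \<and> 1 < snd (?s n)}"
    by (auto simp: image_iff gr0_conv_Suc)
  hence "(INF n\<in>{n. 0 < n \<and> fst (s n) = 0 \<and> 1 < snd (s n)}. ereal (tsum s n + 1)) =
      (INF n\<in>{n. fst (?s n) = 0 \<and> 1 < snd (?s n)}. ereal (snd (s 0)) + ereal (tsum ?s n + 1))"
    by (simp add: image_image tsum_Suc_shift add.assoc)
  also have "\<dots> = ereal (snd (s 0)) + ftau ?s"
    unfolding ftau_def by (rule INF_ereal_add_real)
  finally show ?thesis .
qed

text \<open>Past the first jump the initial age is forgotten. This form exposes the first holding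
  time as a separate summand, to be integrated out independently of the rest.\<close>

lemma tau_eq_ftau_shift:
  assumes "good_path x" "0 \<le> u" "u < 1"
  shows "tau u x = (if x 0 = 0 \<and> 1 - u < snd (jseq x 0) then ereal (1 - u)
    else ereal (snd (jseq x 0)) + ftau (\<lambda>n. jseq x (Suc n)))"
  using tau_eq_jump_Inf[OF assms] by (simp add: Inf_jumps_shift)

lemma tsum_add: "tsum s (n + m) = tsum s n + tsum (\<lambda>k. s (n + k)) m"
  by (induction m) (simp_all add: tsum_def)

lemma INF_from_index:
  fixes n :: nat and f :: "nat \<Rightarrow> ereal"
  assumes "\<forall>k<n. \<not> Q k"
  shows "(INF m\<in>{m. Q m}. f m) = (INF m\<in>{m. Q (n + m)}. f (n + m))"
proof -
  have "{m. Q m} = (+) n ` {m. Q (n + m)}"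
  proof safe
    fix m assume "Q m"
    have "n \<le> m"
    proof (rule ccontr)
      assume "\<not> n \<le> m"
      hence "m < n" by simp
      thus False using assms \<open>Q m\<close> by auto
    qed
    then obtain k where "m = n + k" using le_Suc_ex by auto
    thus "m \<in> (+) n ` {m. Q (n + m)}" using \<open>Q m\<close> by auto
  qed
  thus ?thesis by (simp add: image_image)
qed

lemma ftau_shift:
  assumes "\<forall>k<n. fst (s k) \<noteq> 0"
  shows "ftau s = ereal (tsum s n) + ftau (\<lambda>k. s (n + k))"
proof -
  have "ftau s = (INF m\<in>{m. fst (s (n + m)) = 0 \<and> 1 < snd (s (n + m))}. ereal (tsum s (n + m) + 1))"
    unfolding ftau_def by (rule INF_from_index) (use assms in simp)
  thus ?thesis by (simp add: ftau_def tsum_add INF_ereal_add_real[symmetric] add.assoc)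
qed

lemma ftau0_shift:
  assumes "\<forall>k<n. fst (s k) \<noteq> 0"
  shows "ftau0 s = ereal (tsum s n) + ftau0 (\<lambda>k. s (n + k))"
proof -
  have "ftau0 s = (INF m\<in>{m. fst (s (n + m)) = 0}. ereal (tsum s (n + m)))"
    unfolding ftau0_def by (rule INF_from_index) (use assms in simp)
  thus ?thesis by (simp add: ftau0_def tsum_add INF_ereal_add_real[symmetric])
qed

lemma ftau0_at_0:
  assumes "\<forall>k. 0 \<le> snd (s k)" "fst (s 0) = 0"
  shows "ftau0 s = 0"
proof (rule antisym)
  have "ftau0 s \<le> ereal (tsum s 0)"
    unfolding ftau0_def using assms(2) by (intro INF_lower) simp
  thus "ftau0 s \<le> 0" by (simp add: tsum_def zero_ereal_def)
  show "0 \<le> ftau0 s"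
    unfolding ftau0_def
  proof (rule INF_greatest)
    fix n
    have "0 \<le> tsum s n" unfolding tsum_def by (rule sum_nonneg) (use assms(1) in blast)
    thus "0 \<le> ereal (tsum s n)" by simp
  qed
qed

lemma tau_eq_ftau:
  assumes "good_path x"
  shows "tau 0 x = ftau (jseq x)"
proof (cases "x 0 = 0 \<and> 1 < snd (jseq x 0)")
  case True
  have "ftau (jseq x) = 1"
    unfolding ftau_def using True tsum_jseq_nonneg[OF assms]
    by (intro antisym INF_greatest INF_lower2[of 0]) (auto simp: fst_jseq_0[OF assms] one_ereal_def tsum_def)
  thus ?thesis using tau_eq_jump_Inf[OF assms, of 0] True by (simp add: one_ereal_def)
next
  case False
  hence "{n. 0 < n \<and> fst (jseq x n) = 0 \<and> 1 < snd (jseq x n)} = {n. fst (jseq x n) = 0 \<and> 1 < snd (jseq x n)}"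
    by (auto simp: fst_jseq_0[OF assms] intro!: Nat.gr0I)
  thus ?thesis using tau_eq_jump_Inf[OF assms, of 0] False by (simp add: ftau_def)
qed

section \<open>Measurability\<close>

text \<open>By right continuity the state at time T is j iff it is j at all rational times in some
  interval to the right of T, a countable condition. The \<open>max 0\<close> is there because
  \<open>X t\<close> is known to be measurable only for t \<ge> 0.\<close>

lemma measurable_at_random_time:
  fixes X :: "real \<Rightarrow> 'a \<Rightarrow> nat"
  assumes X: "\<And>t. 0 \<le> t \<Longrightarrow> X t \<in> measurable M (count_space UNIV)"
    and rc: "\<And>w. w \<in> space M \<Longrightarrow> rc_path (\<lambda>t. X t w)"
    and T: "T \<in> borel_measurable M" "\<And>w. w \<in> space M \<Longrightarrow> 0 \<le> T w"
  shows "(\<lambda>w. X (T w) w) \<in> measurable M (count_space UNIV)"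
proof -
  have eq: "X (T w) w = j \<longleftrightarrow> (\<exists>m::nat. \<forall>q::rat. T w < of_rat q \<and> of_rat q < T w + 1 / Suc m \<longrightarrow>
      X (max 0 (of_rat q)) w = j)" if w: "w \<in> space M" for w j
  proof
    assume j: "X (T w) w = j"
    obtain b where b: "T w < b" "\<forall>r\<in>{T w<..<b}. X r w = X (T w) w"
      using rc_pathE[OF rc[OF w] T(2)[OF w]] .
    obtain m where "inverse (real (Suc m)) < b - T w" using reals_Archimedean[of "b - T w"] b by auto
    moreover have "max 0 (of_rat q) = (of_rat q :: real)" if "T w < of_rat q" for q
      using that T(2)[OF w] by linarith
    ultimately have "\<forall>q::rat. T w < of_rat q \<and> of_rat q < T w + 1 / Suc m \<longrightarrow> X (max 0 (of_rat q)) w = j"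
      using b(2) j by (auto simp: inverse_eq_divide)
    thus "\<exists>m::nat. \<forall>q::rat. T w < of_rat q \<and> of_rat q < T w + 1 / Suc m \<longrightarrow> X (max 0 (of_rat q)) w = j" ..
  next
    assume "\<exists>m::nat. \<forall>q::rat. T w < of_rat q \<and> of_rat q < T w + 1 / Suc m \<longrightarrow> X (max 0 (of_rat q)) w = j"
    then obtain m :: nat where m: "\<And>q::rat. T w < of_rat q \<Longrightarrow> of_rat q < T w + 1 / Suc m \<Longrightarrow> X (max 0 (of_rat q)) w = j"
      by blast
    obtain q where q: "T w < of_rat q" "of_rat q < T w + 1 / Suc m" "X (of_rat q) w = X (T w) w"
      using rc_path_rat[OF rc[OF w] T(2)[OF w], of "T w + 1 / Suc m"] by auto
    have "max 0 (of_rat q) = (of_rat q :: real)" using q T(2)[OF w] by simp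
    thus "X (T w) w = j" using m[OF q(1,2)] q(3) by simp
  qed
  have [measurable]: "X (max 0 (of_rat q)) \<in> measurable M (count_space UNIV)" for q
    by (rule X) simp
  note T(1)[measurable]
  show ?thesis
  proof (rule measurable_count_space_eq2_countable[THEN iffD2], safe)
    fix j
    have "(\<lambda>w. X (T w) w) -` {j} \<inter> space M = {w \<in> space M. \<exists>m::nat. \<forall>q::rat. T w < of_rat q \<and>
        of_rat q < T w + 1 / Suc m \<longrightarrow> X (max 0 (of_rat q)) w = j}"
      using eq by auto
    also have "\<dots> \<in> sets M" by measurable
    finally show "(\<lambda>w. X (T w) w) -` {j} \<inter> space M \<in> sets M" .
  qed auto
qed

abbreviation seqM :: "(nat \<Rightarrow> nat \<times> real) measure" where
  "seqM \<equiv> PiM UNIV (\<lambda>_. count_space UNIV \<Otimes>\<^sub>M borel)"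

lemma space_seqM [simp]: "space seqM = UNIV"
  by (auto simp: space_PiM space_pair_measure)

lemma measurable_fst_seq: "(\<lambda>s. fst (s n)) \<in> measurable seqM (count_space UNIV)"
  by measurable

lemma measurable_snd_seq: "(\<lambda>s. snd (s n)) \<in> borel_measurable seqM"
  by measurable

lemma measurable_tsum [measurable]: "(\<lambda>s. tsum s n) \<in> borel_measurable seqM"
  unfolding tsum_def by measurable

text \<open>The index set depends on the sequence. Moving the condition into the values gives an
  infimum over a fixed countable set, which is measurable.\<close>

lemma INF_if_top: "(INF n\<in>{n. P n}. f n) = (INF n. if P n then f n else \<infinity> :: ereal)"
proof (rule antisym)
  show "(INF n. if P n then f n else \<infinity>) \<le> (INF n\<in>{n. P n}. f n)"
  proof (rule INF_greatest)
    fix n assume "n \<in> {n. P n}"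
    thus "(INF n. if P n then f n else \<infinity>) \<le> f n" by (intro INF_lower2[of n]) auto
  qed
qed (auto intro!: INF_greatest intro: INF_lower simp del: if_image_distrib)

lemma measurable_ftau [measurable]: "ftau \<in> borel_measurable seqM"
  unfolding ftau_def[abs_def] INF_if_top by measurable

lemma measurable_ftau0 [measurable]: "ftau0 \<in> borel_measurable seqM"
  unfolding ftau0_def[abs_def] INF_if_top by measurable

lemma measurable_shift: "(\<lambda>s k. s (n + k)) \<in> measurable seqM seqM"
  by (rule measurable_PiM_single') (auto simp: space_pair_measure)

lemma measurable_shift_Suc: "(\<lambda>s k. s (Suc k)) \<in> measurable seqM seqM"
  by (rule measurable_PiM_single') (auto simp: space_pair_measure)

lemma measurable_cons:
  assumes "f \<in> measurable M (count_space UNIV \<Otimes>\<^sub>M borel)" "g \<in> measurable M seqM"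
  shows "(\<lambda>w. case_nat (f w) (g w)) \<in> measurable M seqM"
  using assms by (rule measurable_case_nat')

context
  fixes M :: "'a measure" and X :: "real \<Rightarrow> 'a \<Rightarrow> nat"
  assumes X_measurable: "\<And>t. 0 \<le> t \<Longrightarrow> X t \<in> measurable M (count_space UNIV)"
    and X_rc: "\<And>w. w \<in> space M \<Longrightarrow> rc_path (\<lambda>t. X t w)"
begin

lemma measurable_jump_time: "(\<lambda>w. jump_time (\<lambda>t. X t w) n) \<in> borel_measurable M"
proof (induction n)
  case (Suc n)
  note Suc[measurable]
  let ?T = "\<lambda>w. jump_time (\<lambda>t. X t w) n"
  define Z where "Z = (\<lambda>q::rat. X (max 0 (of_rat q)))"
  define Y where "Y = (\<lambda>w. X (real_of_ereal (?T w)) w)"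
  have [measurable]: "Z q \<in> measurable M (count_space UNIV)" for q
    unfolding Z_def by (rule X_measurable) simp
  have [measurable]: "Y \<in> measurable M (count_space UNIV)"
    unfolding Y_def by (rule measurable_at_random_time[OF X_measurable X_rc])
      (auto intro!: real_of_ereal_pos jump_time_nonneg)
  show ?case
  proof (rule borel_measurableI_less)
    fix y :: ereal
    have "{w \<in> space M. jump_time (\<lambda>t. X t w) (Suc n) < y} =
      {w \<in> space M. \<exists>q::rat. 0 \<le> q \<and> ?T w \<le> ereal (of_rat q) \<and> ereal (of_rat q) < y \<and>
        X (max 0 (of_rat q)) w \<noteq> X (real_of_ereal (?T w)) w}" (is "?L = ?R")
    proof (intro Collect_cong conj_cong refl iffI)
      fix w assume w: "w \<in> space M" "jump_time (\<lambda>t. X t w) (Suc n) < y"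
      then obtain t where t: "?T w \<le> ereal t" "ereal t < y" "X t w \<noteq> X (real_of_ereal (?T w)) w"
        by (auto simp: Inf_less_iff jump_time.simps(2))
      have t0: "0 \<le> t" using order_trans[OF jump_time_nonneg t(1)] by simp
      obtain c where c: "t < c" "ereal c \<le> y"
        using t(2) by (cases y) (auto intro: that[of "t + 1"])
      obtain q where q: "t < of_rat q" "of_rat q < c" "X (of_rat q) w = X t w"
        using rc_path_rat[OF X_rc[OF w(1)] t0 c(1)] .
      have "(0::real) \<le> of_rat q" using q(1) t0 by linarith
      hence "0 \<le> q" by simp
      moreover have "?T w \<le> ereal (of_rat q)" using t(1) q(1)
        by (meson ereal_less_eq(3) less_imp_le order_trans)
      moreover have "ereal (of_rat q) < y" using q(2) c(2)
        by (meson less_ereal.simps(1) order_less_le_trans)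
      ultimately show "\<exists>q::rat. 0 \<le> q \<and> ?T w \<le> ereal (of_rat q) \<and> ereal (of_rat q) < y \<and>
        X (max 0 (of_rat q)) w \<noteq> X (real_of_ereal (?T w)) w"
        using q(3) t(3) by (intro exI[of _ q]) (auto simp: max_def)
    next
      fix w assume "\<exists>q::rat. 0 \<le> q \<and> ?T w \<le> ereal (of_rat q) \<and> ereal (of_rat q) < y \<and>
        X (max 0 (of_rat q)) w \<noteq> X (real_of_ereal (?T w)) w"
      then obtain q :: rat where "0 \<le> q" "?T w \<le> ereal (of_rat q)" "ereal (of_rat q) < y"
        "X (of_rat q) w \<noteq> X (real_of_ereal (?T w)) w"
        by (auto simp: max_def)
      thus "jump_time (\<lambda>t. X t w) (Suc n) < y"
        by (auto simp: Inf_less_iff jump_time.simps(2))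
    qed
    \<comment> \<open>The inequality of two discrete random variables is spelled out over the
      countably many values \<open>j\<close>, so that measurability can be derived
      automatically.\<close>
    also have "?R = {w \<in> space M. \<exists>q::rat. 0 \<le> q \<and> ?T w \<le> ereal (of_rat q) \<and> ereal (of_rat q) < y \<and>
        (\<exists>j. Z q w = j \<and> Y w \<noteq> j)}"
      by (auto simp: Z_def Y_def)
    also have "\<dots> \<in> sets M" by measurable
    finally show "?L \<in> sets M" .
  qed
qed simp

lemma measurable_jump_chain: "(\<lambda>w. jump_chain (\<lambda>t. X t w) n) \<in> measurable M (count_space UNIV)"
proof (induction n)
  case 0
  show ?case using X_measurable[of 0] by simp
next
  case (Suc n)
  note Suc[measurable] measurable_jump_time[measurable]
  have [measurable]: "(\<lambda>w. X (real_of_ereal (jump_time (\<lambda>t. X t w) (Suc n))) w) \<in> measurable M (count_space UNIV)"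
    by (rule measurable_at_random_time[OF X_measurable X_rc])
      (auto intro!: real_of_ereal_pos jump_time_nonneg)
  show ?case by (simp only: jump_chain.simps) measurable
qed

lemma measurable_jseq: "(\<lambda>w. jseq (\<lambda>t. X t w)) \<in> measurable M seqM"
proof (rule measurable_PiM_single')
  fix n :: nat
  note measurable_jump_time[measurable] measurable_jump_chain[measurable]
  show "(\<lambda>w. jseq (\<lambda>t. X t w) n) \<in> measurable M (count_space UNIV \<Otimes>\<^sub>M borel)"
    unfolding jseq_def jump_hold_def by measurable
qed (auto simp: space_pair_measure)

text \<open>Rational approximation from the right stays inside the interval except at its right end,
  which is itself rational.\<close>

lemma rat_all_zero_iff:
  assumes "w \<in> space M" "0 \<le> a"
  shows "(\<forall>r\<in>{of_rat a..of_rat b}. X r w = 0) \<longleftrightarrow>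
    (\<forall>q::rat. a \<le> q \<and> q \<le> b \<longrightarrow> X (max 0 (of_rat q)) w = 0)"
proof safe
  fix q assume "\<forall>r\<in>{of_rat a..of_rat b}. X r w = 0" "a \<le> q" "q \<le> b"
  thus "X (max 0 (of_rat q)) w = 0" using assms(2) by (auto simp: max_def of_rat_less_eq)
next
  fix r :: real assume *: "\<forall>q::rat. a \<le> q \<and> q \<le> b \<longrightarrow> X (max 0 (of_rat q)) w = 0"
    and r: "r \<in> {of_rat a..of_rat b}"
  have a0: "(0::real) \<le> of_rat a" using assms(2) by simp
  show "X r w = 0"
  proof (cases "r = of_rat b")
    case True
    thus ?thesis using *[rule_format, of b] r a0 by (auto simp: max_def of_rat_less_eq)
  next
    case False
    hence "r < of_rat b" using r by simp
    then obtain q where q: "r < of_rat q" "of_rat q < (of_rat b :: real)" "X (of_rat q) w = X r w"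
      using rc_path_rat[OF X_rc[OF assms(1)] order_trans[OF a0], of r "of_rat b"] r by auto
    have "of_rat a < (of_rat q :: real)" using r q by simp
    hence "a \<le> q" "q \<le> b" using q by (auto simp: of_rat_less)
    thus ?thesis using *[rule_format, of q] q a0 r by (auto simp: max_def)
  qed
qed

lemma measurable_tau0: "(\<lambda>w. tau0 (\<lambda>t. X t w)) \<in> borel_measurable M"
proof (rule borel_measurableI_less)
  fix y :: ereal
  define Z where "Z = (\<lambda>q::rat. X (max 0 (of_rat q)))"
  have [measurable]: "Z q \<in> measurable M (count_space UNIV)" for q
    unfolding Z_def by (rule X_measurable) simp
  have "{w \<in> space M. tau0 (\<lambda>t. X t w) < y} =
      {w \<in> space M. \<exists>q::rat. 0 \<le> q \<and> ereal (of_rat q) < y \<and> X (max 0 (of_rat q)) w = 0}" (is "?L = ?R")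
  proof (intro Collect_cong conj_cong refl iffI)
    fix w assume w: "w \<in> space M" "tau0 (\<lambda>t. X t w) < y"
    then obtain t where t: "0 \<le> t" "ereal t < y" "X t w = 0"
      by (auto simp: tau0_def Inf_less_iff)
    obtain c where c: "t < c" "ereal c \<le> y"
      using t(2) by (cases y) (auto intro: that[of "t + 1"])
    obtain q where q: "t < of_rat q" "of_rat q < c" "X (of_rat q) w = X t w"
      using rc_path_rat[OF X_rc[OF w(1)] t(1) c(1)] .
    have "(0::real) \<le> of_rat q" using q(1) t by linarith
    hence "0 \<le> q" by simp
    moreover have "ereal (of_rat q) < y" using q(2) c(2)
      by (meson less_ereal.simps(1) order_less_le_trans)
    ultimately show "\<exists>q::rat. 0 \<le> q \<and> ereal (of_rat q) < y \<and> X (max 0 (of_rat q)) w = 0"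
      using q(3) t(3) by (intro exI[of _ q]) (auto simp: max_def)
  next
    fix w assume "\<exists>q::rat. 0 \<le> q \<and> ereal (of_rat q) < y \<and> X (max 0 (of_rat q)) w = 0"
    then obtain q :: rat where "0 \<le> q" "ereal (of_rat q) < y" "X (of_rat q) w = 0"
      by (auto simp: max_def)
    thus "tau0 (\<lambda>t. X t w) < y"
      unfolding tau0_def Inf_less_iff by (intro bexI[of _ "ereal (of_rat q)"]) auto
  qed
  also have "?R = {w \<in> space M. \<exists>q::rat. 0 \<le> q \<and> ereal (of_rat q) < y \<and> Z q w = 0}"
    by (simp add: Z_def)
  also have "\<dots> \<in> sets M" by measurable
  finally show "?L \<in> sets M" .
qed

text \<open>Each of the two alternatives in \<open>tau_eq_Inf\<close> persists until the path leaves
  0, hence still holds at some rational time shortly after t.\<close>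

lemma measurable_tau:
  assumes u: "0 \<le> u"
  shows "(\<lambda>w. tau u (\<lambda>t. X t w)) \<in> borel_measurable M"
proof (rule borel_measurableI_less)
  fix y :: ereal
  define Z where "Z = (\<lambda>q::rat. X (max 0 (of_rat q)))"
  have [measurable]: "Z q \<in> measurable M (count_space UNIV)" for q
    unfolding Z_def by (rule X_measurable) simp
  let ?B = "\<lambda>t w. (\<forall>r\<in>{0..t}. X r w = 0) \<and> 1 \<le> u + t \<or> 1 \<le> t \<and> (\<forall>r\<in>{t-1..t}. X r w = 0)"
  have "{w \<in> space M. tau u (\<lambda>t. X t w) < y} =
      {w \<in> space M. \<exists>q::rat. 0 \<le> q \<and> ereal (of_rat q) < y \<and> ?B (of_rat q) w}" (is "?L = ?R")
  proof (intro Collect_cong conj_cong refl iffI)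
    fix w assume w: "w \<in> space M" "tau u (\<lambda>t. X t w) < y"
    then obtain t where t: "0 \<le> t" "ereal t < y" "?B t w"
      unfolding tau_eq_Inf[OF X_rc[OF w(1)] u] by (auto simp: Inf_less_iff)
    obtain b where b: "t < b" "\<forall>r\<in>{t<..<b}. X r w = X t w"
      using rc_pathE[OF X_rc[OF w(1)] t(1)] .
    obtain c where c: "t < c" "ereal c \<le> y"
      using t(2) by (cases y) (auto intro: that[of "t + 1"])
    obtain q where q: "t < of_rat q" "of_rat q < min b c"
      using of_rat_dense[of t "min b c"] b c by auto
    have z: "X r w = 0" if "t \<le> r" "r \<le> of_rat q" for r
    proof -
      have "X t w = 0" using t by auto
      thus ?thesis using b(2) that q by (cases "r = t") auto
    qed
    have "(0::real) \<le> of_rat q" using q(1) t by linarith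
    hence "0 \<le> q" by simp
    moreover have "ereal (of_rat q) < y" using q(2) c(2)
      by (metis less_ereal.simps(1) min_less_iff_conj order_less_le_trans)
    moreover have "?B (of_rat q) w"
      using t(3)
    proof (elim disjE)
      assume A: "(\<forall>r\<in>{0..t}. X r w = 0) \<and> 1 \<le> u + t"
      have "X r w = 0" if "r \<in> {0..of_rat q}" for r
        using A that z[of r] by (cases "r \<le> t") auto
      thus ?thesis using A q(1) by auto
    next
      assume A: "1 \<le> t \<and> (\<forall>r\<in>{t-1..t}. X r w = 0)"
      have "X r w = 0" if "r \<in> {of_rat q - 1..of_rat q}" for r
        using A that z[of r] q(1) by (cases "r \<le> t") auto
      moreover have "1 \<le> (of_rat q::real)" using A q(1) by linarith
      ultimately show ?thesis by blast
    qed
    ultimately show "\<exists>q::rat. 0 \<le> q \<and> ereal (of_rat q) < y \<and> ?B (of_rat q) w" by blast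
  next
    fix w assume w: "w \<in> space M" and "\<exists>q::rat. 0 \<le> q \<and> ereal (of_rat q) < y \<and> ?B (of_rat q) w"
    then obtain q :: rat where "0 \<le> q" "ereal (of_rat q) < y" "?B (of_rat q) w" by blast
    thus "tau u (\<lambda>t. X t w) < y"
      unfolding tau_eq_Inf[OF X_rc[OF w] u] Inf_less_iff by (intro bexI[of _ "ereal (of_rat q)"]) auto
  qed
  also have "?R = {w \<in> space M. \<exists>q::rat. 0 \<le> q \<and> ereal (of_rat q) < y \<and>
     ((\<forall>p::rat. 0 \<le> p \<and> p \<le> q \<longrightarrow> Z p w = 0) \<and> 1 \<le> u + of_rat q \<or>
      1 \<le> q \<and> (\<forall>p::rat. q - 1 \<le> p \<and> p \<le> q \<longrightarrow> Z p w = 0))}"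
  proof (intro Collect_cong conj_cong refl ex_cong1 disj_cong)
    fix w and q :: rat assume w: "w \<in> space M" and q: "0 \<le> q"
    show "(\<forall>r\<in>{0..of_rat q}. X r w = 0) \<longleftrightarrow> (\<forall>p::rat. 0 \<le> p \<and> p \<le> q \<longrightarrow> Z p w = 0)"
      using rat_all_zero_iff[OF w, of 0 q] by (simp add: Z_def)
    show "(1 \<le> (of_rat q::real)) = (1 \<le> q)" by simp
    assume "1 \<le> q"
    thus "(\<forall>r\<in>{of_rat q - 1..of_rat q}. X r w = 0) \<longleftrightarrow> (\<forall>p::rat. q - 1 \<le> p \<and> p \<le> q \<longrightarrow> Z p w = 0)"
      using rat_all_zero_iff[OF w, of "q - 1" q] by (simp add: of_rat_diff Z_def)
  qed
  also have "\<dots> \<in> sets M" by measurable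
  finally show "?L \<in> sets M" .
qed

end

section \<open>The law of the jump sequence\<close>

definition cyl :: "nat \<Rightarrow> (nat \<Rightarrow> nat) \<Rightarrow> (nat \<Rightarrow> real) \<Rightarrow> (nat \<Rightarrow> nat \<times> real) set" where
  "cyl n y t = {s. \<forall>k\<le>n. fst (s k) = y k \<and> t k < snd (s k)}"

lemma cyl_sets: "cyl n y t \<in> sets seqM"
proof -
  note measurable_fst_seq[measurable] measurable_snd_seq[measurable]
  have "{s \<in> space seqM. \<forall>k\<in>{..n}. fst (s k) = y k \<and> t k < snd (s k)} \<in> sets seqM"
    by measurable
  thus ?thesis by (simp add: cyl_def Ball_def)
qed

lemma sets_chain_hold:
  fixes Y :: "nat \<Rightarrow> 'a \<Rightarrow> nat" and H :: "nat \<Rightarrow> 'a \<Rightarrow> ereal"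
  assumes [measurable]: "\<And>k. Y k \<in> measurable M (count_space UNIV)" "\<And>k. H k \<in> borel_measurable M"
  shows "{w \<in> space M. \<forall>k\<le>n. Y k w = y k \<and> c k < H k w} \<in> sets M"
    and "{w \<in> space M. (\<forall>k\<le>n. Y k w = y k) \<and> H n w = \<infinity>} \<in> sets M"
proof -
  have "{w \<in> space M. \<forall>k\<in>{..n}. Y k w = y k \<and> c k < H k w} \<in> sets M" by measurable
  thus "{w \<in> space M. \<forall>k\<le>n. Y k w = y k \<and> c k < H k w} \<in> sets M" by (simp add: Ball_def)
  have "{w \<in> space M. (\<forall>k\<in>{..n}. Y k w = y k) \<and> H n w = \<infinity>} \<in> sets M" by measurable
  thus "{w \<in> space M. (\<forall>k\<le>n. Y k w = y k) \<and> H n w = \<infinity>} \<in> sets M" by (simp add: Ball_def)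
qed

lemma cyl_Int_same:
  "m \<le> n \<Longrightarrow> cyl m y t \<inter> cyl n z u =
    (if \<forall>k\<le>m. y k = z k then cyl n z (\<lambda>k. if k \<le> m then max (t k) (u k) else u k) else {})"
  unfolding cyl_def by (auto; metis order_trans)

text \<open>Cylinders prescribing different states are disjoint, which is why \<open>{}\<close>
  joins the generator.\<close>

lemma Int_stable_cyl: "Int_stable (insert {} {cyl n y t |n y t. True})"
proof (rule Int_stableI)
  fix A B assume "A \<in> insert {} {cyl n y t |n y t. True}" "B \<in> insert {} {cyl n y t |n y t. True}"
  then consider "A = {} \<or> B = {}" | m y t n z u where "A = cyl m y t" "B = cyl n z u" by blast
  thus "A \<inter> B \<in> insert {} {cyl n y t |n y t. True}"
  proof cases
    case 2
    have *: "cyl m y t \<inter> cyl n z u \<in> insert {} {cyl n y t |n y t. True}" if "m \<le> n" for m n y t z u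
      unfolding cyl_Int_same[OF that] by auto
    show ?thesis
    proof (cases "m \<le> n")
      case True
      thus ?thesis using *[OF True] 2 by simp
    next
      case False
      hence "n \<le> m" by simp
      from *[OF this] show ?thesis unfolding 2 by (subst Int_commute)
    qed
  qed auto
qed

text \<open>A list codes the first n + 1 states, which makes the union countable, and the bounds -N
  exhaust all holding times. The flag \<open>b\<close> switches the constraint on the last holding
  time, so that one identity serves both coordinates and the covering of the space.\<close>

lemma cyl_cover: "(\<Union>l::nat list. \<Union>N::nat. cyl n (\<lambda>k. l ! k) (\<lambda>k. if k = n \<and> b then a else - real N)) =
   {s. b \<longrightarrow> a < snd (s n)}"
proof (intro set_eqI iffI)
  fix s :: "nat \<Rightarrow> nat \<times> real" assume s: "s \<in> {s. b \<longrightarrow> a < snd (s n)}"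
  define B where "B = (\<Sum>k\<le>n. \<bar>snd (s k)\<bar>)"
  obtain N where N: "B < real N" using reals_Archimedean2 by blast
  have "- real N < snd (s k)" if "k \<le> n" for k
  proof -
    have "\<bar>snd (s k)\<bar> \<le> B" unfolding B_def using that by (intro member_le_sum) auto
    thus ?thesis using N by linarith
  qed
  hence "s \<in> cyl n (\<lambda>k. map (\<lambda>k. fst (s k)) [0..<Suc n] ! k) (\<lambda>k. if k = n \<and> b then a else - real N)"
    using s by (auto simp: cyl_def simp del: upt_Suc)
  thus "s \<in> (\<Union>l::nat list. \<Union>N::nat. cyl n (\<lambda>k. l ! k) (\<lambda>k. if k = n \<and> b then a else - real N))"
    by blast
qed (auto simp: cyl_def)

lemma sets_seqM_eq: "sets seqM = sigma_sets UNIV (insert {} {cyl n y t |n y t. True})"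
proof
  let ?G = "insert {} {cyl n y t |n y t. True}"
  let ?S = "sigma UNIV ?G"
  have sets_S: "sets ?S = sigma_sets UNIV ?G" by (rule sets_measure_of) auto
  have cyl_in: "cyl n y t \<in> sets ?S" for n y t
    unfolding sets_S by (rule sigma_sets.Basic) auto
  have "(\<lambda>s. s) \<in> measurable ?S seqM"
  proof (rule measurable_PiM_single')
    fix n :: nat
    have "(\<lambda>s. fst (s n)) \<in> measurable ?S (count_space UNIV)"
    proof (rule measurable_count_space_eq2_countable[THEN iffD2], safe)
      fix j :: nat
      have "(\<lambda>s. fst (s n)) -` {j} \<inter> space ?S =
        (\<Union>l\<in>{l. l ! n = j}. \<Union>N::nat. cyl n (\<lambda>k. l ! k) (\<lambda>k. - real N))"
        using cyl_cover[of n False 0] by (auto simp: cyl_def space_measure_of_conv set_eq_iff) (metis order_refl)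
      also have "\<dots> \<in> sets ?S" by (intro sets.countable_UN'' countableI_type cyl_in)
      finally show "(\<lambda>s. fst (s n)) -` {j} \<inter> space ?S \<in> sets ?S" .
    qed auto
    moreover have "(\<lambda>s. snd (s n)) \<in> borel_measurable ?S"
    proof (rule borel_measurableI_greater)
      fix a :: real
      have "{s \<in> space ?S. a < snd (s n)} =
          (\<Union>l::nat list. \<Union>N::nat. cyl n (\<lambda>k. l ! k) (\<lambda>k. if k = n \<and> True then a else - real N))"
        unfolding cyl_cover by (simp add: space_measure_of_conv)
      also have "\<dots> \<in> sets ?S" by (intro sets.countable_UN'' countableI_type cyl_in)
      finally show "{s \<in> space ?S. a < snd (s n)} \<in> sets ?S" .
    qed
    ultimately show "(\<lambda>s. s n) \<in> measurable ?S (count_space UNIV \<Otimes>\<^sub>M borel)"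
      by (simp add: measurable_pair_iff comp_def)
  qed (auto simp: space_pair_measure)
  hence "(\<lambda>s. s) -` A \<inter> space ?S \<in> sets ?S" if "A \<in> sets seqM" for A
    using that by (rule measurable_sets)
  thus "sets seqM \<subseteq> sigma_sets UNIV ?G"
    using sets_S by (auto simp: space_measure_of_conv)
next
  have "insert {} {cyl n y t |n y t. True} \<subseteq> sets seqM" using cyl_sets by auto
  from sets.sigma_sets_subset[OF this]
  show "sigma_sets UNIV (insert {} {cyl n y t |n y t. True}) \<subseteq> sets seqM"
    by (simp only: space_seqM)
qed

lemma measure_eqI_cyl:
  assumes "sets M = sets seqM" "sets N = sets seqM" "finite_measure M"
    and "\<And>n y t. emeasure M (cyl n y t) = emeasure N (cyl n y t)"
  shows "M = N"
proof (rule measure_eqI_generator_eq_countable[OF Int_stable_cyl])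
  let ?A = "\<Union>l::nat list. \<Union>N::nat. {cyl 0 (\<lambda>k. l ! k) (\<lambda>k. if k = 0 \<and> False then 0 else - real N)}"
  show "?A \<subseteq> insert {} {cyl n y t |n y t. True}" by auto
  have "\<Union>?A = (\<Union>l::nat list. \<Union>N::nat. cyl 0 (\<lambda>k. l ! k) (\<lambda>k. if k = 0 \<and> False then 0 else - real N))"
    by blast
  thus "\<Union>?A = UNIV" using cyl_cover[of 0 False 0] by simp
  show "countable ?A" by auto
  show "emeasure M a \<noteq> \<infinity>" for a using finite_measure.emeasure_finite[OF assms(3)] by auto
qed (use assms sets_seqM_eq in auto)

section \<open>Almost sure path properties and the induced law on sequences\<close>

locale recurrent_ctmc = ctmc S Q P X
  for S :: "nat set" and Q :: "nat \<Rightarrow> nat \<Rightarrow> real" and P :: "nat \<Rightarrow> 'w measure" and X :: "real \<Rightarrow> 'w \<Rightarrow> nat" +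
  assumes zero_in_S: "0 \<in> S" and nontrivial: "\<exists>i\<in>S. i \<noteq> 0"
    and irreducible: "irreducible_chain S P X"
    and non_explosive: "non_explosive S P X"
    and recurrent: "recurrent_chain S P X"
begin

abbreviation traj :: "'w \<Rightarrow> real \<Rightarrow> nat" where
  "traj w \<equiv> \<lambda>r. X r w"

lemma path_rc: "i \<in> S \<Longrightarrow> w \<in> space (P i) \<Longrightarrow> rc_path (traj w)"
  using right_continuous by (auto simp: rc_path_def)

lemma path_measurable:
  assumes "i \<in> S"
  shows "(\<lambda>w. jump_time (traj w) n) \<in> borel_measurable (P i)"
    and "(\<lambda>w. jump_chain (traj w) n) \<in> measurable (P i) (count_space UNIV)"
    and "(\<lambda>w. jseq (traj w)) \<in> measurable (P i) seqM"
    and "(\<lambda>w. tau0 (traj w)) \<in> borel_measurable (P i)"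
    and "0 \<le> u \<Longrightarrow> (\<lambda>w. tau u (traj w)) \<in> borel_measurable (P i)"
proof -
  have X: "X t \<in> measurable (P i) (count_space UNIV)" if "0 \<le> t" for t
    using measurable_X assms that .
  have rc: "rc_path (traj w)" if "w \<in> space (P i)" for w
    using path_rc assms that .
  show "(\<lambda>w. jump_time (traj w) n) \<in> borel_measurable (P i)"
    by (rule measurable_jump_time[OF X rc])
  show "(\<lambda>w. jump_chain (traj w) n) \<in> measurable (P i) (count_space UNIV)"
    by (rule measurable_jump_chain[OF X rc])
  show "(\<lambda>w. jseq (traj w)) \<in> measurable (P i) seqM"
    by (rule measurable_jseq[OF X rc])
  show "(\<lambda>w. tau0 (traj w)) \<in> borel_measurable (P i)"
    by (rule measurable_tau0[OF X rc])
  show "(\<lambda>w. tau u (traj w)) \<in> borel_measurable (P i)" if "0 \<le> u"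
    by (rule measurable_tau[OF X rc that])
qed

lemma measurable_jump_hold: "i \<in> S \<Longrightarrow> (\<lambda>w. jump_hold (traj w) n) \<in> borel_measurable (P i)"
  unfolding jump_hold_def by (intro borel_measurable_ereal_diff path_measurable(1))

lemma chain_hold_sets:
  assumes "i \<in> S"
  shows "{w \<in> space (P i). \<forall>k\<le>n. jump_chain (traj w) k = y k \<and> c k < jump_hold (traj w) k} \<in> sets (P i)"
    and "{w \<in> space (P i). (\<forall>k\<le>n. jump_chain (traj w) k = y k) \<and> jump_hold (traj w) n = \<infinity>} \<in> sets (P i)"
  using sets_chain_hold[where Y="\<lambda>k w. jump_chain (traj w) k" and H="\<lambda>k w. jump_hold (traj w) k",
      OF path_measurable(2)[OF assms] measurable_jump_hold[OF assms]]
  by blast+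

lemma jump_chain_in_S: "i \<in> S \<Longrightarrow> w \<in> space (P i) \<Longrightarrow> jump_chain (traj w) n \<in> S"
  by (induction n) (auto intro!: X_in_S[of i] real_of_ereal_pos jump_time_nonneg)

lemma hold_0_law:
  assumes "i \<in> S" "0 \<le> t"
  shows "measure (P i) {w \<in> space (P i). jump_chain (traj w) 0 = i \<and> ereal t < jump_hold (traj w) 0} = exp (- exit_rate Q i * t)"
  using jump_law[of i 0 "\<lambda>_. i" "\<lambda>_. t"] assms by simp

text \<open>A state with rate 0 would be absorbing, and no other state could be reached from it,
  against irreducibility.\<close>

lemma exit_rate_pos:
  assumes i: "i \<in> S"
  shows "0 < exit_rate Q i"
proof -
  interpret prob_space "P i" using prob_space_P[OF i] .
  have "exp (- exit_rate Q i * 1) \<le> 1"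
    by (subst hold_0_law[OF i, symmetric]) auto
  hence nonneg: "0 \<le> exit_rate Q i" by simp
  have "exit_rate Q i \<noteq> 0"
  proof
    assume q: "exit_rate Q i = 0"
    have "AE w in P i. jump_chain (traj w) 0 = i \<and> ereal (real n) < jump_hold (traj w) 0" for n
      using hold_0_law[OF i, of "real n"] q chain_hold_sets(1)[OF i, of 0 "\<lambda>_. i" "\<lambda>_. ereal (real n)"]
      by (subst prob_Collect_eq_1[symmetric]) auto
    hence "AE w in P i. \<forall>n. jump_chain (traj w) 0 = i \<and> ereal (real n) < jump_hold (traj w) 0"
      by (simp add: AE_all_countable)
    hence const: "AE w in P i. \<forall>t\<ge>0. X t w = i"
    proof eventually_elim
      case (elim w)
      have "jump_hold (traj w) 0 = \<infinity>" 
        using elim by (intro ereal_top) (meson less_imp_le order_trans real_arch_simple ereal_less_eq(3))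
      hence inf: "jump_time (traj w) 1 = \<infinity>"
        by (cases "jump_time (traj w) 1") (auto simp: jump_hold_def)
      show ?case
      proof (intro allI impI, rule ccontr)
        fix t :: real assume "0 \<le> t" "X t w \<noteq> i"
        hence "jump_time (traj w) (Suc 0) \<le> ereal t"
          using elim unfolding jump_time.simps(2) by (intro Inf_lower) auto
        thus False using inf by simp
      qed
    qed
    obtain j where j: "j \<in> S" "j \<noteq> i" using nontrivial zero_in_S by metis
    let ?A = "{w \<in> space (P i). \<exists>t\<ge>0. X t w = j}"
    have pos: "0 < measure (P i) ?A" using irreducible i j by (simp add: irreducible_chain_def)
    hence "?A \<in> sets (P i)" using measure_notin_sets by fastforce
    moreover have "AE w in P i. w \<notin> ?A" using const by eventually_elim (use j in auto)
    ultimately have "emeasure (P i) ?A = 0" by (subst (asm) AE_iff_measurable[OF _ refl]) auto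
    thus False using pos by (simp add: measure_def)
  qed
  thus ?thesis using nonneg by simp
qed

text \<open>\<open>jump_law\<close> speaks of prescribed states only, so the event is split over the
  countably many lists of the first n + 1 states. On each piece the n-th holding time exceeds m with
  a probability decaying exponentially in m.\<close>

lemma hold_finite_AE:
  assumes i: "i \<in> S"
  shows "AE w in P i. \<forall>n. jump_hold (traj w) n \<noteq> \<infinity>"
  unfolding AE_all_countable
proof
  fix n
  interpret prob_space "P i" using prob_space_P[OF i] .
  have "AE w in P i. \<not> ((\<forall>k\<le>n. jump_chain (traj w) k = l ! k) \<and> jump_hold (traj w) n = \<infinity>)" for l
  proof (cases "\<forall>k\<le>n. l ! k \<in> S")
    case True
    let ?A = "\<lambda>m. {w \<in> space (P i). \<forall>k\<le>n. jump_chain (traj w) k = l ! k \<and>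
          ereal (if k = n then real m else 0) < jump_hold (traj w) k}"
    let ?B = "{w \<in> space (P i). (\<forall>k\<le>n. jump_chain (traj w) k = l ! k) \<and> jump_hold (traj w) n = \<infinity>}"
    define c where "c = (if l ! 0 = i then 1 else 0) * (\<Prod>k<n. jump_prob Q (l ! k) (l ! Suc k))"
    have "prob (?A m) = c * exp (- exit_rate Q (l ! n) * real m)" for m
    proof -
      have "(\<Prod>k\<le>n. exp (- exit_rate Q (l ! k) * (if k = n then real m else 0))) = exp (- exit_rate Q (l ! n) * real m)"
        by (subst prod.remove[of _ n]) (auto intro!: prod.neutral)
      thus ?thesis unfolding c_def by (subst jump_law) (use True i in \<open>auto split: if_splits\<close>)
    qed
    moreover have "prob ?B \<le> prob (?A m)" for m
    proof (rule finite_measure_mono)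
      show "?B \<subseteq> ?A m" using jump_hold_pos[OF path_rc[OF i]] by (auto simp: zero_ereal_def)
      show "?A m \<in> sets (P i)"
        by (rule chain_hold_sets(1)[OF i])
    qed
    ultimately have le: "prob ?B \<le> c * exp (- exit_rate Q (l ! n) * real m)" for m by simp
    have q: "0 < exit_rate Q (l ! n)" using True exit_rate_pos by simp
    have "(\<lambda>m. c * exp (- exit_rate Q (l ! n) * real m)) \<longlonglongrightarrow> c * 0"
      by (intro tendsto_mult tendsto_const filterlim_compose[OF exp_at_bot]
        filterlim_tendsto_neg_mult_at_bot[OF tendsto_const _ filterlim_real_sequentially]) (use q in auto)
    hence "prob ?B \<le> 0" using le by (intro LIMSEQ_le_const) auto
    hence "prob ?B = 0" by (simp add: measure_le_0_iff)
    have "?B \<in> sets (P i)"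
      by (rule chain_hold_sets(2)[OF i])
    moreover have "emeasure (P i) ?B = 0" using \<open>prob ?B = 0\<close> by (simp only: emeasure_eq_measure ennreal_0)
    moreover have "{w \<in> space (P i). \<not> \<not> ((\<forall>k\<le>n. jump_chain (traj w) k = l ! k) \<and> jump_hold (traj w) n = \<infinity>)} \<subseteq> ?B"
      by blast
    ultimately show ?thesis by (intro AE_I)
  next
    case False
    thus ?thesis using jump_chain_in_S[OF i] by (intro AE_I2) metis
  qed
  hence "AE w in P i. \<forall>l. \<not> ((\<forall>k\<le>n. jump_chain (traj w) k = l ! k) \<and> jump_hold (traj w) n = \<infinity>)"
    by (simp only: AE_all_countable) blast
  thus "AE w in P i. jump_hold (traj w) n \<noteq> \<infinity>"
  proof eventually_elim
    case (elim w)
    have "\<forall>k\<le>n. jump_chain (traj w) k = map (jump_chain (traj w)) [0..<Suc n] ! k"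
      by (auto simp del: upt_Suc)
    thus ?case using elim by blast
  qed
qed

lemma good_AE:
  assumes i: "i \<in> S"
  shows "AE w in P i. good_path (traj w)"
proof -
  have "AE w in P i. (SUP n. jump_time (traj w) n) = \<infinity>"
    using non_explosive i by (simp add: non_explosive_def)
  thus ?thesis using hold_finite_AE[OF i] AE_space
  proof eventually_elim
    case (elim w)
    have "jump_time (traj w) n \<noteq> \<infinity>" for n
    proof (induction n)
      case (Suc n)
      have "jump_hold (traj w) n \<noteq> \<infinity>" using elim by blast
      thus ?case using Suc jump_time_neq_MInf[of "traj w" n]
        by (cases "jump_time (traj w) n"; cases "jump_time (traj w) (Suc n)") (auto simp: jump_hold_def)
    qed simp
    thus ?case using elim path_rc[OF i] by (simp add: good_path_def)
  qed
qed

text \<open>The point mass outside \<open>S\<close> is an arbitrary default that makes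
  \<open>seq_law\<close> a probability kernel on all of nat, as integration over the state after a
  jump requires.\<close>

definition seq_law :: "nat \<Rightarrow> (nat \<Rightarrow> nat \<times> real) measure" where
  "seq_law i = (if i \<in> S then distr (P i) seqM (\<lambda>w. jseq (traj w)) else return seqM (\<lambda>_. (0, 0)))"

lemma sets_seq_law [simp, measurable_cong]: "sets (seq_law i) = sets seqM"
  by (simp add: seq_law_def)

lemma space_seq_law [simp]: "space (seq_law i) = UNIV"
  by (simp add: seq_law_def)

lemma prob_space_seq_law: "prob_space (seq_law i)"
  using prob_space.prob_space_distr[OF prob_space_P path_measurable(3)]
  by (auto simp: seq_law_def intro!: prob_space_return)

lemma measurable_seq_law: "seq_law \<in> measurable (count_space UNIV) (subprob_algebra seqM)"
  using prob_space_seq_law by (auto simp: space_subprob_algebra intro: prob_space_imp_subprob_space)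

lemma AE_seq_law:
  assumes "i \<in> S" "AE w in P i. R (jseq (traj w))" "Measurable.pred seqM R"
  shows "AE s in seq_law i. R s"
proof -
  have "(AE s in distr (P i) seqM (\<lambda>w. jseq (traj w)). R s) \<longleftrightarrow> (AE w in P i. R (jseq (traj w)))"
    by (rule AE_distr_iff[OF path_measurable(3)]) (use assms in \<open>auto simp: pred_def\<close>)
  moreover have "seq_law i = distr (P i) seqM (\<lambda>w. jseq (traj w))" using assms(1) by (simp add: seq_law_def)
  ultimately show ?thesis using assms(2) by (simp only:)
qed

text \<open>\<open>jump_law\<close> asks for nonnegative bounds; since holding times are almost
  surely positive, a negative bound may be raised to 0.\<close>

lemma seq_law_cyl:
  assumes i: "i \<in> S"
  shows "emeasure (seq_law i) (cyl n y t) = ennreal (if y 0 = i \<and> (\<forall>k\<le>n. y k \<in> S)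
    then (\<Prod>k<n. jump_prob Q (y k) (y (Suc k))) * (\<Prod>k\<le>n. exp (- exit_rate Q (y k) * max 0 (t k))) else 0)"
proof -
  interpret prob_space "P i" using prob_space_P[OF i] .
  let ?B = "{w \<in> space (P i). jseq (traj w) \<in> cyl n y t}"
  have eq: "emeasure (seq_law i) (cyl n y t) = prob ?B"
    using i path_measurable(3)[OF i] by (simp add: seq_law_def emeasure_distr cyl_sets emeasure_eq_measure vimage_def Int_def conj_commute)
  show ?thesis
  proof (cases "\<forall>k\<le>n. y k \<in> S")
    case True
    let ?A = "{w \<in> space (P i). \<forall>k\<le>n. jump_chain (traj w) k = y k \<and> ereal (max 0 (t k)) < jump_hold (traj w) k}"
    have A: "?A \<in> sets (P i)"
      by (rule chain_hold_sets(1)[OF i])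
    have B: "?B \<in> sets (P i)" using measurable_sets[OF path_measurable(3)[OF i] cyl_sets[of n y t]]
      by (simp add: vimage_def Int_def conj_commute)
    have "AE w in P i. w \<in> ?B \<longleftrightarrow> w \<in> ?A"
      using good_AE[OF i] 
    proof eventually_elim
      case (elim w)
      show ?case using jseq_hold_pos[OF elim]
        by (auto simp: cyl_def jump_hold_eq[OF elim]) (auto simp: jseq_def)
    qed
    hence "prob ?B = prob ?A" using B A by (rule finite_measure_eq_AE)
    also have "\<dots> = (if y 0 = i then 1 else 0) * (\<Prod>k<n. jump_prob Q (y k) (y (Suc k))) *
        (\<Prod>k\<le>n. exp (- exit_rate Q (y k) * max 0 (t k)))"
      by (rule jump_law) (use True i in auto)
    finally show ?thesis using True eq by simp
  next
    case False
    then obtain k where "k \<le> n" "y k \<notin> S" by blast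
    hence "jseq (traj w) \<notin> cyl n y t" if "w \<in> space (P i)" for w
      using jump_chain_in_S[OF i that, of k] by (auto simp: cyl_def jseq_def)
    hence "?B = {}" by blast
    hence "prob ?B = 0" by (simp only: measure_empty)
    hence "emeasure (seq_law i) (cyl n y t) = 0" using eq by (simp only: ennreal_0)
    moreover have "(if y 0 = i \<and> (\<forall>k\<le>n. y k \<in> S) then c else 0) = 0" for c :: real
      using False by meson
    ultimately show ?thesis by (simp only: ennreal_0)
  qed
qed

end

section \<open>The first jump\<close>

lemma all_le_Suc_iff: "(\<forall>k\<le>Suc m. R k) \<longleftrightarrow> R 0 \<and> (\<forall>k\<le>m. R (Suc k))"
proof safe
  fix k assume "R 0" "\<forall>k\<le>m. R (Suc k)" "k \<le> Suc m"
  thus "R k" by (cases k) auto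
qed auto

context recurrent_ctmc
begin

lemma seq_law_AE:
  assumes i: "i \<in> S"
  shows "AE s in seq_law i. fst (s 0) = i \<and> (\<forall>k. 0 < snd (s k) \<and> fst (s k) \<in> S)"
proof (rule AE_seq_law[OF i])
  interpret prob_space "P i" using prob_space_P[OF i] .
  have "AE w in P i. jump_chain (traj w) 0 = i \<and> ereal 0 < jump_hold (traj w) 0"
    using hold_0_law[OF i, of 0] chain_hold_sets(1)[OF i, of 0 "\<lambda>_. i" "\<lambda>_. ereal 0"]
    by (subst prob_Collect_eq_1[symmetric]) auto
  thus "AE w in P i. fst (jseq (traj w) 0) = i \<and> (\<forall>k. 0 < snd (jseq (traj w) k) \<and> fst (jseq (traj w) k) \<in> S)"
    using good_AE[OF i] AE_space
  proof eventually_elim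
    case (elim w)
    thus ?case using jseq_hold_pos[of "traj w"] jump_chain_in_S[OF i, of w] by (simp add: jseq_def)
  qed
  note measurable_fst_seq[measurable] measurable_snd_seq[measurable]
  show "Measurable.pred seqM (\<lambda>s. fst (s 0) = i \<and> (\<forall>k. 0 < snd (s k) \<and> fst (s k) \<in> S))"
    by measurable
qed

definition expo :: "nat \<Rightarrow> real measure" where
  "expo i = density lborel (exponential_density (exit_rate Q i))"

text \<open>As an image of \<open>seq_law\<close> this has mass 1 at once, without summing
  \<open>jump_prob\<close> over a row.\<close>

definition first_jump :: "nat \<Rightarrow> nat measure" where
  "first_jump i = distr (seq_law i) (count_space UNIV) (\<lambda>s. fst (s 1))"

definition after_jump :: "nat \<Rightarrow> (nat \<Rightarrow> nat \<times> real) measure" where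
  "after_jump i = first_jump i \<bind> seq_law"

lemma sets_expo [simp, measurable_cong]: "sets (expo i) = sets borel"
  by (simp add: expo_def)

lemma prob_space_expo: "i \<in> S \<Longrightarrow> prob_space (expo i)"
  unfolding expo_def by (rule prob_space_exponential_density[OF exit_rate_pos])

lemma emeasure_expo:
  assumes i: "i \<in> S"
  shows "emeasure (expo i) {a<..} = ennreal (exp (- exit_rate Q i * max 0 a))"
proof -
  interpret E: prob_space "expo i" by (rule prob_space_expo[OF i])
  have "distributed (expo i) lborel (\<lambda>x. x) (exponential_density (exit_rate Q i))"
    unfolding distributed_def expo_def by (auto simp: distr_id2)
  from E.exponential_distributedD_gt[OF this _ exit_rate_pos[OF i]]
  have *: "emeasure (expo i) {a<..} = ennreal (exp (- exit_rate Q i * a))" if "0 \<le> a" for a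
    unfolding E.emeasure_eq_measure using that by (simp add: greaterThan_def expo_def mult.commute)
  show ?thesis
  proof (cases "0 \<le> a")
    case False
    have "1 \<le> emeasure (expo i) {a<..}"
      using *[of 0] emeasure_mono[of "{0<..}" "{a<..}" "expo i"] False by auto
    moreover have "emeasure (expo i) {a<..} \<le> 1" by (rule E.emeasure_le_1)
    ultimately show ?thesis using False by (simp add: max_def)
  qed (simp add: * max_def)
qed

lemma sets_first_jump [simp, measurable_cong]: "sets (first_jump i) = sets (count_space UNIV)"
  by (simp add: first_jump_def)

lemma space_first_jump [simp]: "space (first_jump i) = UNIV"
  by (simp add: first_jump_def)

lemma measurable_fst_seq_law: "(\<lambda>s. fst (s n)) \<in> measurable (seq_law i) (count_space UNIV)"
  using measurable_fst_seq by (simp add: measurable_cong_sets[OF sets_seq_law refl])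

lemma prob_space_first_jump: "prob_space (first_jump i)"
  unfolding first_jump_def by (rule prob_space.prob_space_distr[OF prob_space_seq_law measurable_fst_seq_law])

lemma first_jump_in_S:
  assumes "i \<in> S"
  shows "AE j in first_jump i. j \<in> S"
  unfolding first_jump_def
  by (subst AE_distr_iff[OF measurable_fst_seq_law]) (use seq_law_AE[OF assms] in auto)

lemma emeasure_first_jump:
  assumes "i \<in> S" "j \<in> S"
  shows "emeasure (first_jump i) {j} = ennreal (jump_prob Q i j)"
proof -
  have "emeasure (first_jump i) {j} = emeasure (seq_law i) {s. fst (s 1) = j}"
    unfolding first_jump_def by (subst emeasure_distr[OF measurable_fst_seq_law]) (auto intro!: arg_cong2[of _ _ _ _ emeasure])
  also have "\<dots> = emeasure (seq_law i) (cyl 1 (case_nat i (\<lambda>_. j)) (\<lambda>_. 0))"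
  proof (rule emeasure_eq_AE)
    show "AE s in seq_law i. s \<in> {s. fst (s 1) = j} \<longleftrightarrow> s \<in> cyl 1 (case_nat i (\<lambda>_. j)) (\<lambda>_. 0)"
      using seq_law_AE[OF assms(1)]
    proof eventually_elim
      case (elim s)
      have "k \<le> 1 \<longleftrightarrow> k = 0 \<or> k = 1" for k :: nat by auto
      thus ?case using elim by (auto simp: cyl_def)
    qed
    show "{s. fst (s 1) = j} \<in> sets (seq_law i)"
      using measurable_sets[OF measurable_fst_seq_law, of "{j}" 1 i] by (simp add: vimage_def)
  qed (simp add: cyl_sets)
  also have "\<dots> = ennreal (jump_prob Q i j)"
    using assms by (subst seq_law_cyl) (auto simp: le_Suc_eq)
  finally show ?thesis .
qed

lemma measurable_seq_law': "seq_law \<in> measurable (first_jump i) (subprob_algebra seqM)"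
  using measurable_seq_law by (simp add: measurable_cong_sets[OF sets_first_jump refl])

lemma sets_after_jump [simp, measurable_cong]: "sets (after_jump i) = sets seqM"
  unfolding after_jump_def by (rule sets_bind) auto

lemma space_after_jump [simp]: "space (after_jump i) = UNIV"
  using sets_eq_imp_space_eq[OF sets_after_jump, of i] by simp

lemma prob_space_after_jump: "prob_space (after_jump i)"
  unfolding after_jump_def
  by (rule prob_space.prob_space_bind[OF prob_space_first_jump _ measurable_seq_law']) (simp add: prob_space_seq_law)

lemma after_jump_cyl:
  assumes i: "i \<in> S"
  shows "emeasure (after_jump i) (cyl n y t) = ennreal (if \<forall>k\<le>n. y k \<in> S then jump_prob Q i (y 0) *
    ((\<Prod>k<n. jump_prob Q (y k) (y (Suc k))) * (\<Prod>k\<le>n. exp (- exit_rate Q (y k) * max 0 (t k)))) else 0)"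
proof -
  define c where "c = (if \<forall>k\<le>n. y k \<in> S then (\<Prod>k<n. jump_prob Q (y k) (y (Suc k))) * (\<Prod>k\<le>n. exp (- exit_rate Q (y k) * max 0 (t k))) else 0)"
  have "emeasure (after_jump i) (cyl n y t) = (\<integral>\<^sup>+j. emeasure (seq_law j) (cyl n y t) \<partial>first_jump i)"
    unfolding after_jump_def by (rule emeasure_bind[OF _ measurable_seq_law' cyl_sets]) simp
  also have "\<dots> = (\<integral>\<^sup>+j. ennreal c * indicator {y 0} j \<partial>first_jump i)"
  proof (rule nn_integral_cong_AE)
    show "AE j in first_jump i. emeasure (seq_law j) (cyl n y t) = ennreal c * indicator {y 0} j"
      using first_jump_in_S[OF i]
    proof eventually_elim
      case (elim j)
      have "emeasure (seq_law j) (cyl n y t) = ennreal (if y 0 = j then c else 0)"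
        unfolding seq_law_cyl[OF elim] c_def
        by (rule arg_cong[of _ _ ennreal]) (cases "y 0 = j"; simp only: if_True if_False simp_thms)
      thus ?case by (auto simp: indicator_def)
    qed
  qed
  also have "\<dots> = ennreal c * emeasure (first_jump i) {y 0}"
    by (rule nn_integral_cmult_indicator) simp
  also have "\<dots> = ennreal (if \<forall>k\<le>n. y k \<in> S then jump_prob Q i (y 0) * c else 0)"
  proof (cases "\<forall>k\<le>n. y k \<in> S")
    case True
    hence y0: "y 0 \<in> S" by simp
    have "0 \<le> jump_prob Q i j" if "i \<in> S" "j \<in> S" for i j
      using that Q_matrix exit_rate_pos[of i] by (auto simp: jump_prob_def Q_matrix_def)
    hence "0 \<le> c" using True by (auto simp: c_def intro!: mult_nonneg_nonneg prod_nonneg)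
    thus ?thesis using True by (simp add: emeasure_first_jump[OF i y0] ennreal_mult'[symmetric] mult.commute)
  next
    case False
    hence "c = 0" unfolding c_def by (rule if_not_P)
    thus ?thesis unfolding if_not_P[OF False] by simp
  qed
  also have "(if \<forall>k\<le>n. y k \<in> S then jump_prob Q i (y 0) * c else 0) = (if \<forall>k\<le>n. y k \<in> S then jump_prob Q i (y 0) *
    ((\<Prod>k<n. jump_prob Q (y k) (y (Suc k))) * (\<Prod>k\<le>n. exp (- exit_rate Q (y k) * max 0 (t k)))) else 0)"
    unfolding c_def by (rule if_cong[OF refl _ refl], subst if_P) (assumption, rule refl)
  finally show ?thesis .
qed

lemma measurable_case_pair:
  "(\<lambda>(h, s). case_nat (i, h) s) \<in> measurable (borel \<Otimes>\<^sub>M seqM) seqM"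
  unfolding case_prod_beta' by (rule measurable_cons) auto

lemma measurable_case_expo:
  "(\<lambda>(h, s). case_nat (i, h) s) \<in> measurable (expo i \<Otimes>\<^sub>M after_jump i) seqM"
  using measurable_case_pair
  by (simp add: measurable_cong_sets[OF sets_pair_measure_cong[OF sets_expo sets_after_jump] refl])

text \<open>In the product formula for a cylinder the factor of index 0 splits off: the first
  holding time is exponential and independent of everything after the jump. Agreement on cylinders
  suffices.\<close>

lemma seq_law_one_step:
  assumes i: "i \<in> S"
  shows "seq_law i = distr (expo i \<Otimes>\<^sub>M after_jump i) seqM (\<lambda>(h, s). case_nat (i, h) s)"
proof (rule measure_eqI_cyl)
  show "finite_measure (seq_law i)" using prob_space_seq_law by (rule prob_space.finite_measure)
  interpret E: prob_space "expo i" by (rule prob_space_expo[OF i])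
  interpret A: prob_space "after_jump i" by (rule prob_space_after_jump)
  interpret EA: pair_prob_space "expo i" "after_jump i" ..
  fix n y t
  let ?f = "\<lambda>(h, s). case_nat (i, h) s"
  \<comment> \<open>For n = 0 the cylinder constrains nothing after the first holding time.\<close>
  define B where "B = (case n of 0 \<Rightarrow> UNIV | Suc m \<Rightarrow> cyl m (\<lambda>k. y (Suc k)) (\<lambda>k. t (Suc k)))"
  have B: "B \<in> sets (after_jump i)"
    using sets.top[of seqM] by (auto simp: B_def cyl_sets split: nat.split)
  have vim: "?f -` cyl n y t \<inter> space (expo i \<Otimes>\<^sub>M after_jump i) = (if y 0 = i then {t 0<..} \<times> B else {})"
  proof (cases n)
    case 0
    thus ?thesis by (auto simp: cyl_def B_def space_pair_measure expo_def)
  next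
    case (Suc m)
    show ?thesis
      by (auto simp: Suc cyl_def all_le_Suc_iff B_def space_pair_measure expo_def)
  qed
  have "emeasure (distr (expo i \<Otimes>\<^sub>M after_jump i) seqM ?f) (cyl n y t) =
      (if y 0 = i then emeasure (expo i) {t 0<..} * emeasure (after_jump i) B else 0)"
    by (subst emeasure_distr[OF measurable_case_expo cyl_sets], subst vim)
      (simp add: A.emeasure_pair_measure_Times[OF _ B])
  also have "\<dots> = emeasure (seq_law i) (cyl n y t)"
  proof (cases n)
    case 0
    thus ?thesis using A.emeasure_space_1 i by (simp add: B_def emeasure_expo seq_law_cyl)
  next
    case (Suc m)
    show ?thesis
    proof (cases "\<forall>k\<le>m. y (Suc k) \<in> S")
      case True
      thus ?thesis
        by (simp add: Suc B_def emeasure_expo[OF i] after_jump_cyl[OF i] seq_law_cyl[OF i] all_le_Suc_iff i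
            ennreal_mult'[symmetric] prod.lessThan_Suc_shift prod.atMost_Suc_shift ac_simps
            del: prod.lessThan_Suc prod.atMost_Suc)
    next
      case False
      hence "(\<forall>k\<le>m. y (Suc k) \<in> S) = False" by blast
      thus ?thesis
        by (simp only: Suc B_def nat.case after_jump_cyl[OF i] seq_law_cyl[OF i] all_le_Suc_iff if_False
            simp_thms ennreal_0 mult_zero_right if_cancel)
    qed
  qed
  finally show "emeasure (seq_law i) (cyl n y t) = emeasure (distr (expo i \<Otimes>\<^sub>M after_jump i) seqM ?f) (cyl n y t)" ..
qed simp_all

lemma nn_integral_seq_law_one_step:
  assumes i: "i \<in> S" and f: "f \<in> borel_measurable seqM"
  shows "(\<integral>\<^sup>+s. f s \<partial>seq_law i) = (\<integral>\<^sup>+h. \<integral>\<^sup>+j. \<integral>\<^sup>+s. f (case_nat (i, h) s) \<partial>seq_law j \<partial>first_jump i \<partial>expo i)"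
proof -
  interpret A: prob_space "after_jump i" by (rule prob_space_after_jump)
  have f': "(\<lambda>(h, s). f (case_nat (i, h) s)) \<in> borel_measurable (expo i \<Otimes>\<^sub>M after_jump i)"
    using measurable_compose[OF measurable_case_expo f] by (simp add: case_prod_beta')
  have f'': "(\<lambda>s. f (case_nat (i, h) s)) \<in> borel_measurable seqM" for h
    by (rule measurable_compose[OF measurable_cons f]) auto
  have "(\<integral>\<^sup>+s. f s \<partial>seq_law i) = (\<integral>\<^sup>+p. f (case p of (h, s) \<Rightarrow> case_nat (i, h) s) \<partial>(expo i \<Otimes>\<^sub>M after_jump i))"
    by (subst seq_law_one_step[OF i]) (rule nn_integral_distr[OF measurable_case_expo], use f in simp)
  also have "\<dots> = (\<integral>\<^sup>+p. (case p of (h, s) \<Rightarrow> f (case_nat (i, h) s)) \<partial>(expo i \<Otimes>\<^sub>M after_jump i))"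
    by (simp add: case_prod_beta')
  also have "\<dots> = (\<integral>\<^sup>+h. \<integral>\<^sup>+s. f (case_nat (i, h) s) \<partial>after_jump i \<partial>expo i)"
    using A.nn_integral_fst[OF f'] by simp
  also have "\<dots> = (\<integral>\<^sup>+h. \<integral>\<^sup>+j. \<integral>\<^sup>+s. f (case_nat (i, h) s) \<partial>seq_law j \<partial>first_jump i \<partial>expo i)"
    unfolding after_jump_def by (subst nn_integral_bind[OF f'' measurable_seq_law']) simp
  finally show ?thesis .
qed

end

section \<open>The Markov property at a jump\<close>

lemma tsum_case_nat: "tsum (case_nat (i, h) s) (Suc n) = h + tsum s n"
  by (simp add: tsum_Suc_shift)

context recurrent_ctmc
begin

text \<open>Three instances occur: \<open>V = UNIV\<close> for the state after n jumps,
  \<open>V = - {0}\<close> with \<open>z = 0\<close> for the first visit to 0, and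
  \<open>V = - {0}\<close> with \<open>z\<close> nonzero for a passage that avoids 0.\<close>

definition reach :: "nat \<Rightarrow> nat set \<Rightarrow> nat \<Rightarrow> (nat \<Rightarrow> nat \<times> real) set" where
  "reach n V z = {s. fst (s n) = z \<and> (\<forall>k<n. fst (s k) \<in> V)}"

lemma sets_reach: "reach n V z \<in> sets seqM"
proof -
  note measurable_fst_seq[measurable]
  have "{s \<in> space seqM. fst (s n) = z \<and> (\<forall>k\<in>{..<n}. fst (s k) \<in> V)} \<in> sets seqM"
    by measurable
  thus ?thesis by (simp add: reach_def Ball_def)
qed

lemma reach_case_nat: "case_nat (i, h) s \<in> reach (Suc n) V z \<longleftrightarrow> i \<in> V \<and> s \<in> reach n V z"
  by (auto simp: reach_def less_Suc_eq_0_disj)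

lemma markov_measurable:
  assumes "g \<in> borel_measurable (borel \<Otimes>\<^sub>M seqM)"
  shows "(\<lambda>s. g (tsum s n, \<lambda>k. s (n + k))) \<in> borel_measurable seqM"
    and "(\<lambda>r. \<integral>\<^sup>+s'. g (r, s') \<partial>seq_law z) \<in> borel_measurable borel"
    and "(\<lambda>s. \<integral>\<^sup>+s'. g (tsum s n, s') \<partial>seq_law z) \<in> borel_measurable seqM"
proof -
  interpret Z: prob_space "seq_law z" by (rule prob_space_seq_law)
  show "(\<lambda>s. g (tsum s n, \<lambda>k. s (n + k))) \<in> borel_measurable seqM"
    by (rule measurable_compose[OF measurable_Pair[OF measurable_tsum measurable_shift] assms])
  have "g \<in> borel_measurable (borel \<Otimes>\<^sub>M seq_law z)"
    using assms by (simp add: measurable_cong_sets[OF sets_pair_measure_cong[OF refl sets_seq_law] refl])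
  from Z.borel_measurable_nn_integral_fst[OF this]
  show *: "(\<lambda>r. \<integral>\<^sup>+s'. g (r, s') \<partial>seq_law z) \<in> borel_measurable borel" .
  show "(\<lambda>s. \<integral>\<^sup>+s'. g (tsum s n, s') \<partial>seq_law z) \<in> borel_measurable seqM"
    by (rule measurable_compose[OF measurable_tsum *])
qed

text \<open>The functional \<open>g\<close> sees the elapsed time as well as the future, since
  survival beyond t depends on both. The induction peels steps off the front, where
  \<open>seq_law_one_step\<close> applies.\<close>

lemma markov:
  assumes z: "z \<in> S" and "j \<in> S" and "g \<in> borel_measurable (borel \<Otimes>\<^sub>M seqM)"
  shows "(\<integral>\<^sup>+s. indicator (reach n V z) s * g (tsum s n, \<lambda>k. s (n + k)) \<partial>seq_law j) =
    (\<integral>\<^sup>+s. indicator (reach n V z) s * (\<integral>\<^sup>+s'. g (tsum s n, s') \<partial>seq_law z) \<partial>seq_law j)"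
  using assms(2,3)
proof (induction n arbitrary: j g)
  case (0 j g)
  interpret J: prob_space "seq_law j" by (rule prob_space_seq_law)
  note seq_law_AE[OF 0(1)]
  have eq: "(\<integral>\<^sup>+s. indicator (reach 0 V z) s * F s \<partial>seq_law j) = (if j = z then \<integral>\<^sup>+s. F s \<partial>seq_law j else 0)"
    for F :: "_ \<Rightarrow> ennreal"
  proof -
    have "(\<integral>\<^sup>+s. indicator (reach 0 V z) s * F s \<partial>seq_law j) = (\<integral>\<^sup>+s. (if j = z then F s else 0) \<partial>seq_law j)"
      by (rule nn_integral_cong_AE) (use seq_law_AE[OF 0(1)] in \<open>auto simp: reach_def\<close>)
    thus ?thesis by simp
  qed
  show ?case unfolding eq using J.emeasure_space_1 by (auto simp: tsum_def)
next
  case (Suc n j g)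
  note j = Suc.prems(1) and g = Suc.prems(2)
  have I: "(\<lambda>s. indicator (reach (Suc n) V z) s :: ennreal) \<in> borel_measurable seqM"
    by (rule borel_measurable_indicator[OF sets_reach])
  \<comment> \<open>The first holding time is absorbed into the functional, so the induction
    hypothesis is needed for all \<open>g\<close>.\<close>
  define g' where "g' h p = g (h + fst p, snd p)" for h :: real and p :: "real \<times> (nat \<Rightarrow> nat \<times> real)"
  have g': "g' h \<in> borel_measurable (borel \<Otimes>\<^sub>M seqM)" for h
    unfolding g'_def[abs_def]
    by (rule measurable_compose[OF _ g]) (auto intro!: measurable_Pair)
  have ind: "indicator (reach (Suc n) V z) (case_nat (j, h) s) = (indicator V j * indicator (reach n V z) s :: ennreal)" for h s
    by (auto simp: indicator_def reach_case_nat)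
  have "(\<integral>\<^sup>+s. indicator (reach (Suc n) V z) s * g (tsum s (Suc n), \<lambda>k. s (Suc n + k)) \<partial>seq_law j) =
    (\<integral>\<^sup>+h. \<integral>\<^sup>+l. \<integral>\<^sup>+s. indicator V j * (indicator (reach n V z) s * g' h (tsum s n, \<lambda>k. s (n + k))) \<partial>seq_law l \<partial>first_jump j \<partial>expo j)"
    by (subst nn_integral_seq_law_one_step[OF j borel_measurable_times_ennreal[OF I markov_measurable(1)[OF g]]])
      (simp only: ind tsum_case_nat g'_def fst_conv snd_conv add_Suc nat.case mult.assoc)
  also have "\<dots> = (\<integral>\<^sup>+h. \<integral>\<^sup>+l. indicator V j * (\<integral>\<^sup>+s. indicator (reach n V z) s * g' h (tsum s n, \<lambda>k. s (n + k)) \<partial>seq_law l) \<partial>first_jump j \<partial>expo j)"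
    by (intro nn_integral_cong nn_integral_cmult)
      (simp add: measurable_cong_sets[OF sets_seq_law refl] borel_measurable_times_ennreal[OF borel_measurable_indicator[OF sets_reach] markov_measurable(1)[OF g']])
  also have "\<dots> = (\<integral>\<^sup>+h. \<integral>\<^sup>+l. indicator V j * (\<integral>\<^sup>+s. indicator (reach n V z) s * (\<integral>\<^sup>+s'. g' h (tsum s n, s') \<partial>seq_law z) \<partial>seq_law l) \<partial>first_jump j \<partial>expo j)"
  proof (rule nn_integral_cong, rule nn_integral_cong_AE)
    fix h
    show "AE l in first_jump j. indicator V j * (\<integral>\<^sup>+s. indicator (reach n V z) s * g' h (tsum s n, \<lambda>k. s (n + k)) \<partial>seq_law l) =
      indicator V j * (\<integral>\<^sup>+s. indicator (reach n V z) s * (\<integral>\<^sup>+s'. g' h (tsum s n, s') \<partial>seq_law z) \<partial>seq_law l)"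
      using first_jump_in_S[OF j] by eventually_elim (simp only: Suc.IH[OF _ g'])
  qed
  also have "\<dots> = (\<integral>\<^sup>+h. \<integral>\<^sup>+l. \<integral>\<^sup>+s. indicator V j * (indicator (reach n V z) s * (\<integral>\<^sup>+s'. g' h (tsum s n, s') \<partial>seq_law z)) \<partial>seq_law l \<partial>first_jump j \<partial>expo j)"
    by (intro nn_integral_cong nn_integral_cmult[symmetric])
      (simp add: measurable_cong_sets[OF sets_seq_law refl] borel_measurable_times_ennreal[OF borel_measurable_indicator[OF sets_reach] markov_measurable(3)[OF g']])
  also have "\<dots> = (\<integral>\<^sup>+s. indicator (reach (Suc n) V z) s * (\<integral>\<^sup>+s'. g (tsum s (Suc n), s') \<partial>seq_law z) \<partial>seq_law j)"
    by (subst nn_integral_seq_law_one_step[OF j borel_measurable_times_ennreal[OF I markov_measurable(3)[OF g]]])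
      (simp only: ind tsum_case_nat g'_def fst_conv snd_conv mult.assoc)
  finally show ?case .
qed

end

section \<open>Decomposition at the first visit to 0\<close>

context recurrent_ctmc
begin

lemma measure_seq_law_eq:
  assumes j: "j \<in> S" and A: "A \<in> sets (P j)" and B: "B \<in> sets seqM"
    and "\<And>w. w \<in> space (P j) \<Longrightarrow> good_path (traj w) \<Longrightarrow> X 0 w = j \<Longrightarrow> w \<in> A \<longleftrightarrow> jseq (traj w) \<in> B"
  shows "measure (P j) A = measure (seq_law j) B"
proof -
  interpret prob_space "P j" using prob_space_P[OF j] .
  have "AE w in P j. X 0 w = j"
  proof -
    have "AE w in P j. jump_chain (traj w) 0 = j \<and> ereal 0 < jump_hold (traj w) 0"
      using hold_0_law[OF j, of 0] chain_hold_sets(1)[OF j, of 0 "\<lambda>_. j" "\<lambda>_. ereal 0"]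
      by (subst prob_Collect_eq_1[symmetric]) auto
    thus ?thesis by eventually_elim simp
  qed
  hence *: "AE w in P j. w \<in> A \<longleftrightarrow> w \<in> (\<lambda>w. jseq (traj w)) -` B \<inter> space (P j)"
    using good_AE[OF j] AE_space by eventually_elim (use assms(4) in auto)
  have "measure (seq_law j) B = measure (P j) ((\<lambda>w. jseq (traj w)) -` B \<inter> space (P j))"
    using j path_measurable(3)[OF j] B by (simp add: seq_law_def measure_distr)
  also have "\<dots> = measure (P j) A"
    by (rule finite_measure_eq_AE[symmetric, OF * A measurable_sets[OF path_measurable(3)[OF j] B]])
  finally show ?thesis ..
qed

lemma sets_tail: "{s. ereal t < ftau s} \<in> sets seqM" "{s. ereal t < ftau0 s} \<in> sets seqM"
  using measurable_sets[OF measurable_ftau, of "{ereal t<..}"] measurable_sets[OF measurable_ftau0, of "{ereal t<..}"]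
  by (simp_all add: vimage_def)

lemma surv_hat:
  assumes j: "j \<in> S"
  shows "surv P X (hat j) t = measure (seq_law j) {s. ereal t < ftau s}"
proof -
  have "age (hat j) = 0" "law P (hat j) = P j" by (simp_all add: hat_def)
  hence "surv P X (hat j) t = measure (P j) {w \<in> space (P j). ereal t < tau 0 (traj w)}"
    by (simp only: surv_def)
  also have "\<dots> = measure (seq_law j) {s. ereal t < ftau s}"
  proof (rule measure_seq_law_eq[OF j _ sets_tail(1)])
    show "{w \<in> space (P j). ereal t < tau 0 (traj w)} \<in> sets (P j)"
      by (rule borel_measurable_less) (auto intro: path_measurable(5)[OF j])
  qed (simp add: tau_eq_ftau)
  finally show ?thesis .
qed

lemma tau0_tail:
  assumes j: "j \<in> S"
  shows "measure (P j) {w \<in> space (P j). ereal t < tau0 (traj w)} = measure (seq_law j) {s. ereal t < ftau0 s}"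
proof (rule measure_seq_law_eq[OF j _ sets_tail(2)])
  show "{w \<in> space (P j). ereal t < tau0 (traj w)} \<in> sets (P j)"
    by (rule borel_measurable_less) (auto intro: path_measurable(4)[OF j])
qed (simp add: tau0_eq_ftau0)

text \<open>An event of positive probability cannot be covered by countably many null events. This
  turns irreducibility, a statement about real times, into one about a fixed number of
  jumps.\<close>

lemma ex_pos_seq_law:
  assumes j: "j \<in> S" and pos: "0 < measure (P j) A" and B: "\<And>n::nat. B n \<in> sets seqM"
    and "\<And>w. w \<in> A \<Longrightarrow> w \<in> space (P j) \<Longrightarrow> good_path (traj w) \<Longrightarrow> \<exists>n. jseq (traj w) \<in> B n"
  shows "\<exists>n. 0 < emeasure (seq_law j) (B n)"
proof (rule ccontr)
  assume "\<not> ?thesis"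
  hence "AE s in seq_law j. s \<notin> B n" for n
    using B by (intro AE_not_in) (auto simp: null_sets_def)
  hence AE: "AE s in seq_law j. \<forall>n. s \<notin> B n" by (simp add: AE_all_countable)
  have "AE w in P j. \<forall>n. jseq (traj w) \<notin> B n"
  proof -
    have "seq_law j = distr (P j) seqM (\<lambda>w. jseq (traj w))" using j by (simp add: seq_law_def)
    thus ?thesis using AE_distrD[OF path_measurable(3)[OF j]] AE by (simp only:)
  qed
  hence "AE w in P j. w \<notin> A"
    using good_AE[OF j] AE_space by eventually_elim (use assms(4) in blast)
  moreover have "A \<in> sets (P j)" using pos measure_notin_sets by fastforce
  ultimately have "emeasure (P j) A = 0"
    using AE_iff_measurable[of A "P j" "\<lambda>w. w \<notin> A"] sets.sets_into_space by fastforce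
  thus False using pos by (simp add: measure_def)
qed

text \<open>The visits to 0 occur at unbounded times, hence beyond every jump time and so beyond
  every index.\<close>

lemma return_AE: "AE s in seq_law 0. \<forall>n. \<exists>k. fst (s (n + k)) = 0"
proof (rule AE_seq_law[OF zero_in_S])
  note measurable_fst_seq[measurable]
  show "Measurable.pred seqM (\<lambda>s. \<forall>n. \<exists>k. fst (s (n + k)) = 0)" by measurable
  have "AE w in P 0. \<not> bdd_above {t. 0 \<le> t \<and> X t w = 0}"
    using recurrent zero_in_S by (auto simp: recurrent_chain_def)
  thus "AE w in P 0. \<forall>n. \<exists>k. fst (jseq (traj w) (n + k)) = 0"
    using good_AE[OF zero_in_S]
  proof eventually_elim
    case (elim w)
    show ?case
    proof
      fix n
      let ?T = "tsum (jseq (traj w))"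
      obtain t where t: "0 \<le> t" "X t w = 0" "?T n < t"
        using elim(1) by (auto simp: bdd_above_def not_le)
      obtain m where m: "?T m \<le> t" "t < ?T (Suc m)"
        using ex_jump_interval[OF elim(2) t(1)] .
      have "\<not> Suc m \<le> n" using tsum_jseq_mono[OF elim(2), of "Suc m" n] m t by auto
      moreover have "fst (jseq (traj w) m) = 0" using path_between_jumps[OF elim(2) m] t by simp
      ultimately show "\<exists>k. fst (jseq (traj w) (n + k)) = 0"
        by (intro exI[of _ "m - n"]) simp
    qed
  qed
qed

text \<open>
  Recurrence is assumed of the starting state only; but 0 reaches \<open>j\<close> and must come back from there.
\<close>

lemma hit_AE:
  assumes j: "j \<in> S"
  shows "AE s in seq_law j. \<exists>n. fst (s n) = 0"
proof -
  interpret J: prob_space "seq_law j" by (rule prob_space_seq_law)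
  have "\<exists>n. 0 < emeasure (seq_law 0) (reach n UNIV j)"
  proof (rule ex_pos_seq_law[OF zero_in_S _ sets_reach])
    show "0 < measure (P 0) {w \<in> space (P 0). \<exists>t\<ge>0. X t w = j}"
      using irreducible zero_in_S j by (simp add: irreducible_chain_def)
    fix w assume w: "w \<in> {w \<in> space (P 0). \<exists>t\<ge>0. X t w = j}" "good_path (traj w)"
    then obtain t where t: "0 \<le> t" "X t w = j" by auto
    obtain m where m: "tsum (jseq (traj w)) m \<le> t" "t < tsum (jseq (traj w)) (Suc m)"
      using ex_jump_interval[OF w(2) t(1)] .
    show "\<exists>n. jseq (traj w) \<in> reach n UNIV j"
      using path_between_jumps[OF w(2) m] t by (intro exI[of _ m]) (simp add: reach_def)
  qed
  then obtain n where n: "0 < emeasure (seq_law 0) (reach n UNIV j)" by blast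
  define A where "A = {s :: nat \<Rightarrow> nat \<times> real. \<forall>k. fst (s k) \<noteq> 0}"
  have A: "A \<in> sets seqM"
  proof -
    note measurable_fst_seq[measurable]
    have "{s \<in> space seqM. \<forall>k. fst (s k) \<noteq> 0} \<in> sets seqM" by measurable
    thus ?thesis by (simp add: A_def)
  qed
  define g :: "real \<times> (nat \<Rightarrow> nat \<times> real) \<Rightarrow> ennreal" where "g p = indicator A (snd p)" for p
  have g: "g \<in> borel_measurable (borel \<Otimes>\<^sub>M seqM)"
    unfolding g_def[abs_def] by (rule measurable_compose[OF measurable_snd borel_measurable_indicator[OF A]])
  have "(\<integral>\<^sup>+s. indicator (reach n UNIV j) s * emeasure (seq_law j) A \<partial>seq_law 0) =
      (\<integral>\<^sup>+s. indicator (reach n UNIV j) s * (\<integral>\<^sup>+s'. g (tsum s n, s') \<partial>seq_law j) \<partial>seq_law 0)"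
    using A by (simp add: g_def)
  also have "\<dots> = (\<integral>\<^sup>+s. indicator (reach n UNIV j) s * g (tsum s n, \<lambda>k. s (n + k)) \<partial>seq_law 0)"
    by (rule markov[OF j zero_in_S g, symmetric])
  also have "\<dots> = (\<integral>\<^sup>+s. 0 \<partial>seq_law 0)"
    by (rule nn_integral_cong_AE) (use return_AE in eventually_elim, auto simp: g_def A_def indicator_def)
  finally have "emeasure (seq_law 0) (reach n UNIV j) * emeasure (seq_law j) A = 0"
    using sets_reach by (simp add: nn_integral_multc)
  hence "emeasure (seq_law j) A = 0" using n by auto
  hence "AE s in seq_law j. s \<notin> A" using A by (intro AE_not_in) (simp add: null_sets_def)
  thus ?thesis by eventually_elim (simp add: A_def)
qed

definition hit0 :: "(nat \<Rightarrow> nat \<times> real) \<Rightarrow> real" where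
  "hit0 s = real_of_ereal (ftau0 s)"

lemma measurable_hit0: "hit0 \<in> borel_measurable seqM"
  unfolding hit0_def[abs_def] using measurable_ftau0 by (rule borel_measurable_real_of_ereal)

abbreviation first_zero :: "nat \<Rightarrow> (nat \<Rightarrow> nat \<times> real) set" where
  "first_zero n \<equiv> reach n (- {0}) 0"

lemma ex1_first_zero:
  assumes "\<exists>n. fst (s n) = 0"
  obtains m where "\<forall>n. s \<in> first_zero n \<longleftrightarrow> n = m"
proof
  define m where "m = (LEAST n. fst (s n) = 0)"
  have m: "fst (s m) = 0" unfolding m_def using assms by (rule LeastI_ex)
  have lt: "fst (s k) \<noteq> 0" if "k < m" for k using that not_less_Least unfolding m_def by blast
  have "s \<in> first_zero n \<longleftrightarrow> n = m" for n
    using m lt by (auto simp: reach_def) (metis nat_neq_iff)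
  thus "\<forall>n. s \<in> first_zero n \<longleftrightarrow> n = m" by blast
qed

text \<open>Almost surely exactly one index is that of the first visit to 0. Splitting over it
  allows \<open>markov\<close>, which works at a fixed index, to act at a random one.\<close>

lemma nn_integral_first_zero:
  assumes j: "j \<in> S" and F: "F \<in> borel_measurable seqM"
  shows "(\<integral>\<^sup>+s. F s \<partial>seq_law j) = (\<Sum>n. \<integral>\<^sup>+s. indicator (first_zero n) s * F s \<partial>seq_law j)"
proof -
  have "(\<Sum>n. \<integral>\<^sup>+s. indicator (first_zero n) s * F s \<partial>seq_law j) = (\<integral>\<^sup>+s. (\<Sum>n. indicator (first_zero n) s * F s) \<partial>seq_law j)"
    by (rule nn_integral_suminf[symmetric])
      (simp add: measurable_cong_sets[OF sets_seq_law refl] borel_measurable_times_ennreal[OF borel_measurable_indicator[OF sets_reach] F])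
  also have "\<dots> = (\<integral>\<^sup>+s. F s \<partial>seq_law j)"
  proof (rule nn_integral_cong_AE)
    show "AE s in seq_law j. (\<Sum>n. indicator (first_zero n) s * F s) = F s"
      using hit_AE[OF j]
    proof eventually_elim
      case (elim s)
      obtain m where "\<forall>n. s \<in> first_zero n \<longleftrightarrow> n = m"
        using ex1_first_zero[OF elim] .
      hence "indicator (first_zero n) s * F s = (if n = m then F s else 0)" for n
        by (simp add: indicator_def)
      thus ?case using suminf_finite[of "{m}" "\<lambda>n. if n = m then F s else 0"] by simp
    qed
  qed
  finally show ?thesis ..
qed

lemma hit0_eq_tsum:
  assumes "s \<in> first_zero n" "\<forall>k. 0 < snd (s k)"
  shows "ftau0 s = ereal (tsum s n)" "hit0 s = tsum s n"
proof -
  have "ftau0 s = ereal (tsum s n) + ftau0 (\<lambda>k. s (n + k))"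
    by (rule ftau0_shift) (use assms in \<open>auto simp: reach_def\<close>)
  also have "ftau0 (\<lambda>k. s (n + k)) = 0"
    by (rule ftau0_at_0) (use assms in \<open>auto simp: reach_def intro: less_imp_le\<close>)
  finally show "ftau0 s = ereal (tsum s n)" by simp
  thus "hit0 s = tsum s n" by (simp add: hit0_def)
qed

lemma hit0_AE:
  assumes j: "j \<in> S"
  shows "AE s in seq_law j. ftau0 s = ereal (hit0 s) \<and> 0 \<le> hit0 s"
  using hit_AE[OF j] seq_law_AE[OF j]
proof eventually_elim
  case (elim s)
  obtain m where "\<forall>n. s \<in> first_zero n \<longleftrightarrow> n = m"
    using ex1_first_zero[OF elim(1)] .
  hence m: "s \<in> first_zero m" by blast
  have pos: "\<forall>k. 0 < snd (s k)" using elim(2) by blast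
  have "0 \<le> tsum s m" unfolding tsum_def by (rule sum_nonneg) (use pos in \<open>simp add: less_imp_le\<close>)
  thus ?case unfolding hit0_eq_tsum[OF m pos] by simp
qed

definition tail :: "nat \<Rightarrow> real \<Rightarrow> real" where
  "tail j t = measure (seq_law j) {s. ereal t < ftau s}"

lemma tail_antimono: "antimono (tail j)"
proof (rule antimonoI)
  interpret J: prob_space "seq_law j" by (rule prob_space_seq_law)
  fix t u :: real assume "t \<le> u"
  thus "tail j u \<le> tail j t" unfolding tail_def
    using sets_tail(1)[of t] by (intro J.finite_measure_mono) (auto intro: le_less_trans[of _ "ereal u"])
qed

lemma tail_nonneg: "0 \<le> tail j t" and tail_le_1: "tail j t \<le> 1"
  using prob_space.prob_le_1[OF prob_space_seq_law] by (auto simp: tail_def)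

lemma measurable_tail: "tail j \<in> borel_measurable borel"
proof -
  have "mono (\<lambda>t. - tail j t)" using tail_antimono by (auto simp: monotone_def)
  hence "(\<lambda>t. - (- tail j t)) \<in> borel_measurable borel"
    by (intro borel_measurable_uminus borel_measurable_mono)
  thus ?thesis by simp
qed

lemma tail_decomposition:
  assumes j: "j \<in> S"
  shows "tail j t = (LINT s|seq_law j. tail 0 (t - hit0 s))"
proof -
  interpret J: prob_space "seq_law j" by (rule prob_space_seq_law)
  interpret Z: prob_space "seq_law 0" by (rule prob_space_seq_law)
  let ?A = "\<lambda>r. {s. ereal r < ftau s}"
  define g :: "real \<times> (nat \<Rightarrow> nat \<times> real) \<Rightarrow> ennreal" where
    "g p = indicator {e. ereal t < e} (ereal (fst p) + ftau (snd p))" for p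
  have g: "g \<in> borel_measurable (borel \<Otimes>\<^sub>M seqM)"
  proof -
    have "(\<lambda>p. ereal (fst p) + ftau (snd p)) \<in> borel_measurable (borel \<Otimes>\<^sub>M seqM)"
      by (intro borel_measurable_ereal_add borel_measurable_ereal measurable_fst
        measurable_compose[OF measurable_snd measurable_ftau])
    thus ?thesis unfolding g_def[abs_def]
      by (rule measurable_compose[OF _ borel_measurable_indicator]) (simp flip: greaterThan_def)
  qed
  have m: "(\<lambda>s. ennreal (tail 0 (t - hit0 s))) \<in> borel_measurable seqM"
    by (intro measurable_compose[OF _ measurable_ennreal] measurable_compose[OF _ measurable_tail]
      borel_measurable_diff measurable_hit0 borel_measurable_const)
  have "ennreal (tail j t) = (\<integral>\<^sup>+s. indicator (?A t) s \<partial>seq_law j)"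
    unfolding tail_def using sets_tail(1)[of t] by (simp add: J.emeasure_eq_measure)
  also have "\<dots> = (\<Sum>n. \<integral>\<^sup>+s. indicator (first_zero n) s * indicator (?A t) s \<partial>seq_law j)"
    by (rule nn_integral_first_zero[OF j borel_measurable_indicator[OF sets_tail(1)]])
  \<comment> \<open>No stay at 0 precedes the first visit, so \<open>ftau\<close> is the time of
    that visit plus \<open>ftau\<close> of the remaining sequence.\<close>
  also have "\<dots> = (\<Sum>n. \<integral>\<^sup>+s. indicator (first_zero n) s * g (tsum s n, \<lambda>k. s (n + k)) \<partial>seq_law j)"
  proof (intro arg_cong[of _ _ suminf] ext nn_integral_cong)
    fix n s
    show "indicator (first_zero n) s * indicator (?A t) s = indicator (first_zero n) s * g (tsum s n, \<lambda>k. s (n + k))"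
      using ftau_shift[of n s] by (auto simp: indicator_def g_def reach_def)
  qed
  also have "\<dots> = (\<Sum>n. \<integral>\<^sup>+s. indicator (first_zero n) s * (\<integral>\<^sup>+s'. g (tsum s n, s') \<partial>seq_law 0) \<partial>seq_law j)"
    by (intro arg_cong[of _ _ suminf] ext markov[OF zero_in_S j g])
  also have "\<dots> = (\<Sum>n. \<integral>\<^sup>+s. indicator (first_zero n) s * ennreal (tail 0 (t - hit0 s)) \<partial>seq_law j)"
  proof (intro arg_cong[of _ _ suminf] ext nn_integral_cong_AE)
    fix n
    have eq: "(\<integral>\<^sup>+s'. g (r, s') \<partial>seq_law 0) = ennreal (tail 0 (t - r))" for r
    proof -
      have "g (r, s') = indicator (?A (t - r)) s'" for s'
        by (cases "ftau s'") (auto simp: g_def indicator_def)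
      thus ?thesis unfolding tail_def using sets_tail(1)[of "t - r"] by (simp add: Z.emeasure_eq_measure)
    qed
    show "AE s in seq_law j. indicator (first_zero n) s * (\<integral>\<^sup>+s'. g (tsum s n, s') \<partial>seq_law 0) =
        indicator (first_zero n) s * ennreal (tail 0 (t - hit0 s))"
      using seq_law_AE[OF j]
    proof eventually_elim
      case (elim s)
      show ?case unfolding eq using elim hit0_eq_tsum(2)[of s n] by (cases "s \<in> first_zero n") auto
    qed
  qed
  also have "\<dots> = (\<integral>\<^sup>+s. ennreal (tail 0 (t - hit0 s)) \<partial>seq_law j)"
    by (rule nn_integral_first_zero[OF j m, symmetric])
  finally have *: "ennreal (tail j t) = (\<integral>\<^sup>+s. ennreal (tail 0 (t - hit0 s)) \<partial>seq_law j)" .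
  have "(LINT s|seq_law j. tail 0 (t - hit0 s)) = enn2real (\<integral>\<^sup>+s. ennreal (tail 0 (t - hit0 s)) \<partial>seq_law j)"
  proof (rule integral_eq_nn_integral)
    have "(\<lambda>s. tail 0 (t - hit0 s)) \<in> borel_measurable seqM"
      by (intro measurable_compose[OF _ measurable_tail] borel_measurable_diff measurable_hit0 borel_measurable_const)
    thus "(\<lambda>s. tail 0 (t - hit0 s)) \<in> borel_measurable (seq_law j)"
      by (simp add: measurable_cong_sets[OF sets_seq_law refl])
  qed (simp add: tail_nonneg)
  thus ?thesis unfolding *[symmetric] by (simp add: tail_nonneg)
qed

end

section \<open>Long tails\<close>

text \<open>A unit step back costs a factor of at most exp e as long as it starts beyond T.
  Iterating gives the bound down to T; below T the crude bound 1 on \<open>a\<close> takes over, at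
  the price of a factor 1 / a T.\<close>

lemma long_tailed_exp_bound:
  fixes a :: "real \<Rightarrow> real"
  assumes anti: "antimono a" and pos: "\<And>t. 0 < a t" and le1: "\<And>t. a t \<le> 1"
    and long: "((\<lambda>t. a (t - 1) / a t) \<longlongrightarrow> 1) at_top" and e: "0 < e"
  obtains C T where "\<forall>t\<ge>T. \<forall>y\<ge>0. a (t - y) \<le> C * exp (e * y) * a t"
proof -
  have "\<forall>\<^sub>F t in at_top. a (t - 1) / a t < exp e"
    by (rule order_tendstoD(2)[OF long]) (use e in simp)
  then obtain T where T: "\<And>t. T \<le> t \<Longrightarrow> a (t - 1) / a t < exp e"
    by (auto simp: eventually_at_top_linorder)
  hence step: "a (t - 1) \<le> exp e * a t" if "T \<le> t" for t
    using that pos[of t] by (simp add: divide_less_eq less_imp_le)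
  \<comment> \<open>The last of the n steps starts at t - n + 1, so only this point has to lie
    beyond T and the end point may fall below it.\<close>
  have steps: "a (t - real n) \<le> exp (e * real n) * a t" if "T \<le> t - real n + 1 \<or> n = 0" for t n
    using that
  proof (induction n)
    case (Suc n)
    have "T \<le> t - real n" using Suc.prems by auto
    hence "a (t - real n - 1) \<le> exp e * a (t - real n)" by (rule step)
    also have "\<dots> \<le> exp e * (exp (e * real n) * a t)"
      using Suc.prems by (intro mult_left_mono Suc.IH) auto
    also have "\<dots> = exp (e * real (Suc n)) * a t" by (simp add: algebra_simps exp_add)
    finally show ?case by (simp add: algebra_simps)
  qed simp
  have near: "a (t - y) \<le> exp e * exp (e * y) * a t" if "0 \<le> y" "T \<le> t - y" for t y
  proof -
    define n where "n = nat \<lceil>y\<rceil>"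
    have n: "y \<le> real n" "real n < y + 1" using that by (auto simp: n_def) linarith+
    have "a (t - y) \<le> a (t - real n)" using n by (intro antimonoD[OF anti]) simp
    also have "\<dots> \<le> exp (e * real n) * a t" using n that by (intro steps) auto
    also have "\<dots> \<le> exp (e * (y + 1)) * a t"
      using n e pos[of t] by (intro mult_right_mono) auto
    also have "\<dots> = exp e * exp (e * y) * a t" by (simp add: algebra_simps exp_add)
    finally show ?thesis .
  qed
  show ?thesis
  \<comment> \<open>In the constant, exp e pays for rounding y up to an integer and 1 / a T for the
    values of t - y below T.\<close>
  proof (rule that[of T "exp e / a T"], intro allI impI)
    fix t y :: real assume t: "T \<le> t" and y: "0 \<le> y"
    have ge: "exp e * exp (e * y) * a t \<le> exp e / a T * exp (e * y) * a t"
      using pos[of t] pos[of T] le1[of T] by (intro mult_right_mono) (auto simp: le_divide_eq)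
    show "a (t - y) \<le> exp e / a T * exp (e * y) * a t"
    proof (cases "T \<le> t - y")
      case True
      thus ?thesis using near[OF y True] ge by linarith
    next
      case False
      \<comment> \<open>Going back from t only as far as T shows that the right-hand side is already
        at least 1.\<close>
      have "a T \<le> exp e * exp (e * (t - T)) * a t" using near[of "t - T" t] t by simp
      also have "\<dots> \<le> exp e * exp (e * y) * a t"
        using False e pos[of t] by (intro mult_right_mono mult_left_mono) auto
      finally have "1 \<le> exp e * exp (e * y) * a t / a T" using pos[of T] by (simp add: le_divide_eq)
      thus ?thesis using le1[of "t - y"] by simp
    qed
  qed
qed

text \<open>The exponent in \<open>long_tailed_exp_bound\<close> is free; taking that of the
  exponential moment makes the dominating function integrable.\<close>

lemma long_tailed_light_convolution:
  fixes a :: "real \<Rightarrow> real"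
  assumes anti: "antimono a" and pos: "\<And>t. 0 < a t" and le1: "\<And>t. a t \<le> 1"
    and long: "\<And>v. 0 \<le> v \<Longrightarrow> ((\<lambda>t. a (t - v) / a t) \<longlongrightarrow> 1) at_top"
    and N: "prob_space N" and Y: "Y \<in> borel_measurable N" "AE w in N. 0 \<le> Y w"
    and light: "integrable N (\<lambda>w. exp (e * Y w))" "0 < e"
  shows "((\<lambda>t. (LINT w|N. a (t - Y w)) / a t) \<longlongrightarrow> 1) at_top"
proof -
  interpret prob_space N by (rule N)
  obtain C T where C: "\<forall>t\<ge>T. \<forall>y\<ge>0. a (t - y) \<le> C * exp (e * y) * a t"
    using long_tailed_exp_bound[OF anti pos le1 long[OF zero_le_one] light(2)] .
  have a: "a \<in> borel_measurable borel"
  proof -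
    have "mono (\<lambda>t. - a t)" using anti by (auto simp: monotone_def)
    hence "(\<lambda>t. - (- a t)) \<in> borel_measurable borel"
      by (intro borel_measurable_uminus borel_measurable_mono)
    thus ?thesis by simp
  qed
  have m: "(\<lambda>w. a (t - Y w)) \<in> borel_measurable N" for t
    using Y(1) by (intro measurable_compose[OF _ a]) simp
  have "((\<lambda>t. LINT w|N. a (t - Y w) / a t) \<longlongrightarrow> (LINT w|N. 1)) at_top"
  proof (rule integral_dominated_convergence_at_top[where w = "\<lambda>w. C * exp (e * Y w)"])
    show "\<forall>\<^sub>F t in at_top. AE w in N. norm (a (t - Y w) / a t) \<le> C * exp (e * Y w)"
      using eventually_ge_at_top[of T]
    proof eventually_elim
      case (elim t)
      show ?case using Y(2)
      proof eventually_elim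
        case (elim w)
        thus ?case using C \<open>T \<le> t\<close> pos[of t] pos[of "t - Y w"] by (simp add: divide_le_eq)
      qed
    qed
    show "AE w in N. ((\<lambda>t. a (t - Y w) / a t) \<longlongrightarrow> 1) at_top"
      using Y(2) by eventually_elim (rule long)
  qed (use light m in auto)
  thus ?thesis using prob_space by simp
qed

text \<open>
  If two independent copies exceed \<open>t\<close> in sum, the first copy may exceed \<open>t\<close> alone, or be at most
  \<open>v\<close> with the second one above \<open>t\<close>, or lie in \<open>(v, t]\<close> with the second one above \<open>t - v\<close>.
  Subexponentiality leaves no room for \<open>F(t - v) / F(t)\<close> to exceed 1 in the limit.
\<close>

lemma subexponential_long_tailed:
  assumes M: "prob_space M" and sub: "subexponential M Z"
  defines "F \<equiv> \<lambda>t. 1 - cdf (distr M borel Z) t"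
  shows "0 < F t" and "0 \<le> v \<Longrightarrow> ((\<lambda>t. F (t - v) / F t) \<longlongrightarrow> 1) at_top"
proof -
  define D where "D = distr M borel Z"
  have Z: "Z \<in> borel_measurable M" "AE w in M. 0 \<le> Z w" using sub by (auto simp: subexponential_def)
  interpret D: prob_space D unfolding D_def by (rule prob_space.prob_space_distr[OF M Z(1)])
  interpret DD: pair_prob_space D D ..
  have sets_D [simp, measurable_cong]: "sets D = sets borel" by (simp add: D_def)
  have space_D [simp]: "space D = UNIV" by (simp add: D_def)
  have F: "F t = measure D {t<..}" for t
  proof -
    have "measure D {t<..} = 1 - measure D {..t}"
      using D.prob_compl[of "{..t}"] by (simp add: Compl_eq_Diff_UNIV[symmetric])
    thus ?thesis by (simp add: F_def cdf_def D_def)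
  qed
  have ret: "convolution D (return borel 0) = D"
  proof (rule measure_eqI)
    fix A assume "A \<in> sets (convolution D (return borel 0))"
    hence A: "A \<in> sets borel" by simp
    have "emeasure (convolution D (return borel 0)) A = (\<integral>\<^sup>+x. \<integral>\<^sup>+y. indicator A (x + y) \<partial>return borel 0 \<partial>D)"
      using A by (intro convolution_emeasure') (auto intro: D.finite_measure_axioms prob_space.finite_measure[OF prob_space_return])
    also have "\<dots> = (\<integral>\<^sup>+x. indicator A x \<partial>D)"
      using A by (subst nn_integral_return) auto
    finally show "emeasure (convolution D (return borel 0)) A = emeasure D A" using A by simp
  qed simp
  have lim: "((\<lambda>t. (1 - cdf (conv_power D n) t) / F t) \<longlongrightarrow> real n) at_top" if "1 \<le> n" for n
    using sub that by (simp add: subexponential_def F_def D_def)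
  have anti: "F u \<le> F t" if "t \<le> u" for t u
    unfolding F using that by (intro D.finite_measure_mono) auto
  show pos: "0 < F t" for t
  proof (rule ccontr)
    assume "\<not> 0 < F t"
    hence zero: "F u = 0" if "t \<le> u" for u
      using anti[OF that] measure_nonneg[of D "{u<..}"] \<open>\<not> 0 < F t\<close> F[of u] by linarith
    \<comment> \<open>Division by zero yields 0, so for n = 1 the ratio would tend to 0 instead of
      1.\<close>
    have "\<forall>\<^sub>F u in at_top. (1 - cdf (conv_power D 1) u) / F u = 0"
      using eventually_ge_at_top[of t] by eventually_elim (simp only: zero div_by_0)
    from tendsto_cong[OF this] lim[of 1] show False by (simp add: tendsto_const_iff)
  qed
  show "((\<lambda>t. F (t - v) / F t) \<longlongrightarrow> 1) at_top" if v: "0 \<le> v"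
  proof (rule tendsto_sandwich)
    define G where "G t = 1 - cdf (conv_power D 2) t" for t
    have AE0: "AE x in D. 0 \<le> x"
      unfolding D_def by (subst AE_distr_iff[OF Z(1)]) (use Z(2) in auto)
    have G: "G t = measure (D \<Otimes>\<^sub>M D) {p. t < fst p + snd p}" for t
    proof -
      have c: "conv_power D 2 = convolution D D" by (simp add: numeral_2_eq_2 ret)
      have m: "(\<lambda>p. fst p + snd p) \<in> borel_measurable (D \<Otimes>\<^sub>M D)" by measurable
      have "convolution D D = distr (D \<Otimes>\<^sub>M D) borel (\<lambda>p. fst p + snd p)"
        by (simp add: convolution_def case_prod_beta')
      hence "G t = 1 - measure (D \<Otimes>\<^sub>M D) ((\<lambda>p. fst p + snd p) -` {..t} \<inter> space (D \<Otimes>\<^sub>M D))"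
        unfolding G_def c cdf_def using m by (simp add: measure_distr)
      also have "\<dots> = measure (D \<Otimes>\<^sub>M D) (space (D \<Otimes>\<^sub>M D) - (\<lambda>p. fst p + snd p) -` {..t} \<inter> space (D \<Otimes>\<^sub>M D))"
        by (rule DD.P.prob_compl[symmetric]) (use measurable_sets[OF m] in auto)
      also have "space (D \<Otimes>\<^sub>M D) - (\<lambda>p. fst p + snd p) -` {..t} \<inter> space (D \<Otimes>\<^sub>M D) = {p. t < fst p + snd p}"
        by (auto simp: space_pair_measure)
      finally show ?thesis .
    qed
    have lower: "F t + (1 - F v) * F t + (F v - F t) * F (t - v) \<le> G t" if "v \<le> t" for t
    proof -
      let ?A = "{t<..} \<times> {0..}" and ?B = "{0..v} \<times> {t<..}" and ?C = "{v<..t} \<times> {t - v<..}"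
      have rect: "measure (D \<Otimes>\<^sub>M D) (A \<times> B) = measure D A * measure D B"
        if "A \<in> sets borel" "B \<in> sets borel" for A B
        using that by (simp add: measure_def D.emeasure_pair_measure_Times enn2real_mult)
      have s: "?A \<in> sets (D \<Otimes>\<^sub>M D)" "?B \<in> sets (D \<Otimes>\<^sub>M D)" "?C \<in> sets (D \<Otimes>\<^sub>M D)" by auto
      have "measure (D \<Otimes>\<^sub>M D) ?A + measure (D \<Otimes>\<^sub>M D) ?B + measure (D \<Otimes>\<^sub>M D) ?C = measure (D \<Otimes>\<^sub>M D) (?A \<union> ?B \<union> ?C)"
        using s \<open>v \<le> t\<close> by (subst DD.P.finite_measure_Union, auto)+
      also have "\<dots> \<le> G t"
      proof -
        have "{p \<in> space (D \<Otimes>\<^sub>M D). t < fst p + snd p} \<in> sets (D \<Otimes>\<^sub>M D)" by measurable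
        hence "{p. t < fst p + snd p} \<in> sets (D \<Otimes>\<^sub>M D)" by (simp add: space_pair_measure)
        thus ?thesis unfolding G by (intro DD.P.finite_measure_mono) auto
      qed
      finally have *: "measure D {t<..} * measure D {0..} + measure D {0..v} * measure D {t<..} + measure D {v<..t} * measure D {t - v<..} \<le> G t"
        by (simp add: rect)
      have "measure D {0..} = measure D UNIV"
        by (rule D.finite_measure_eq_AE) (use AE0 in auto)
      hence 1: "measure D {0..} = 1" using D.prob_space by simp
      have "measure D {0..v} = measure D (UNIV - {v<..})"
        by (rule D.finite_measure_eq_AE) (use AE0 in auto)
      hence 2: "measure D {0..v} = 1 - F v" using D.prob_compl[of "{v<..}"] by (simp add: F)
      have "measure D {v<..t} = measure D ({v<..} - {t<..})" by (rule arg_cong[of _ _ "measure D"]) auto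
      also have "\<dots> = F v - F t" unfolding F using \<open>v \<le> t\<close> by (intro D.finite_measure_Diff) auto
      finally show ?thesis using * 1 2 by (simp add: F)
    qed
    have F0: "(F \<longlongrightarrow> 0) at_top"
    proof -
      interpret rd: real_distribution D by standard auto
      have "((\<lambda>t. 1 - cdf D t) \<longlongrightarrow> 1 - 1) at_top" by (intro tendsto_diff tendsto_const rd.cdf_lim_at_top_prob)
      thus ?thesis by (simp add: F_def D_def)
    qed
    show "\<forall>\<^sub>F t in at_top. 1 \<le> F (t - v) / F t"
      using pos anti v by (intro always_eventually allI) (simp add: le_divide_eq)
    have "\<forall>\<^sub>F t in at_top. F t < F v" by (rule order_tendstoD(2)[OF F0 pos])
    thus "\<forall>\<^sub>F t in at_top. F (t - v) / F t \<le> (G t / F t - 1 - (1 - F v)) / (F v - F t)"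
      using eventually_ge_at_top[of v]
    proof eventually_elim
      case (elim t)
      have "(F v - F t) * F (t - v) / F t \<le> (G t - F t - (1 - F v) * F t) / F t"
        using lower[OF elim(2)] pos[of t] by (intro divide_right_mono) auto
      also have "\<dots> = G t / F t - 1 - (1 - F v)" using pos[of t] by (simp add: field_simps)
      finally show ?case using elim(1) pos[of t] by (simp add: le_divide_eq mult.commute)
    qed
    \<comment> \<open>Here subexponentiality enters with n = 2: the numerator tends to 2 - 1 - (1 -
      F v) = F v, which is also the limit of the denominator.\<close>
    have "((\<lambda>t. (G t / F t - 1 - (1 - F v)) / (F v - F t)) \<longlongrightarrow> (real 2 - 1 - (1 - F v)) / (F v - 0)) at_top"
      using pos[of v] unfolding G_def by (intro tendsto_divide tendsto_diff tendsto_const lim F0) auto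
    thus "((\<lambda>t. (G t / F t - 1 - (1 - F v)) / (F v - F t)) \<longlongrightarrow> 1) at_top"
      using pos[of v] by simp
  qed simp
qed

section \<open>First passages and the state (0, u)\<close>

context recurrent_ctmc
begin

definition tail_after_jump :: "real \<Rightarrow> real" where
  "tail_after_jump t = measure (after_jump 0) {s. ereal t < ftau s}"

text \<open>In terms of the first holding time h and the sequence after the jump, survival is the
  set \<open>B'\<close>. Since h adds between 0 and 1 - u to the clock, \<open>B'\<close> lies
  between two rectangles, whose probabilities factor by independence.\<close>

lemma surv_AtZero_bounds:
  assumes u: "0 \<le> u" "u < 1" and t: "1 - u \<le> t"
  defines "c \<equiv> 1 - exp (- exit_rate Q 0 * (1 - u))"
  shows "c * tail_after_jump t \<le> surv P X (AtZero u) t" "surv P X (AtZero u) t \<le> c * tail_after_jump (t - (1 - u))"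
proof -
  interpret E: prob_space "expo 0" by (rule prob_space_expo[OF zero_in_S])
  interpret A: prob_space "after_jump 0" by (rule prob_space_after_jump)
  interpret EA: pair_prob_space "expo 0" "after_jump 0" ..
  have space_E [simp]: "space (expo 0) = UNIV" by (simp add: expo_def)
  define B where "B = {s. \<not> (fst (s 0) = 0 \<and> 1 - u < snd (s 0)) \<and> ereal t < ereal (snd (s 0)) + ftau (\<lambda>n. s (Suc n))}"
  define B' where "B' = {(h, s). h \<le> 1 - u \<and> ereal t < ereal h + ftau s}"
  have B: "B \<in> sets seqM"
  proof -
    note measurable_fst_seq[measurable] measurable_snd_seq[measurable]
    define f where "f = (\<lambda>s. ereal (snd (s 0)) + ftau (\<lambda>n. s (Suc n)))"
    have [measurable]: "f \<in> borel_measurable seqM"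
      unfolding f_def by (intro borel_measurable_ereal_add borel_measurable_ereal measurable_snd_seq
        measurable_compose[OF measurable_shift_Suc measurable_ftau])
    have "{s \<in> space seqM. \<not> (fst (s 0) = 0 \<and> 1 - u < snd (s 0)) \<and> ereal t < f s} \<in> sets seqM"
      by measurable
    thus ?thesis by (simp add: B_def f_def)
  qed
  have vim: "(\<lambda>(h, s). case_nat (0, h) s) -` B \<inter> space (expo 0 \<Otimes>\<^sub>M after_jump 0) = B'"
    by (auto simp: B_def B'_def space_pair_measure)
  have "surv P X (AtZero u) t = measure (P 0) {w \<in> space (P 0). ereal t < tau u (traj w)}"
    by (simp add: surv_def)
  also have "\<dots> = measure (seq_law 0) B"
  proof (rule measure_seq_law_eq[OF zero_in_S _ B])
    show "{w \<in> space (P 0). ereal t < tau u (traj w)} \<in> sets (P 0)"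
      by (rule borel_measurable_less) (auto intro: path_measurable(5)[OF zero_in_S u(1)])
    fix w assume w: "w \<in> space (P 0)" "good_path (traj w)" "X 0 w = 0"
    have "fst (jseq (traj w) 0) = 0" using w fst_jseq_0[OF w(2)] by simp
    thus "w \<in> {w \<in> space (P 0). ereal t < tau u (traj w)} \<longleftrightarrow> jseq (traj w) \<in> B"
      using w t by (simp add: B_def tau_eq_ftau_shift[OF w(2) u])
  qed
  also have "\<dots> = measure (expo 0 \<Otimes>\<^sub>M after_jump 0) ((\<lambda>(h, s). case_nat (0, h) s) -` B \<inter> space (expo 0 \<Otimes>\<^sub>M after_jump 0))"
    by (subst seq_law_one_step[OF zero_in_S], rule measure_distr[OF measurable_case_expo B])
  also note vim
  finally have surv: "surv P X (AtZero u) t = measure (expo 0 \<Otimes>\<^sub>M after_jump 0) B'" .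
  have B': "B' \<in> sets (expo 0 \<Otimes>\<^sub>M after_jump 0)"
    using measurable_sets[OF measurable_case_expo[of 0] B] unfolding vim .
  have rect: "measure (expo 0 \<Otimes>\<^sub>M after_jump 0) (Y \<times> Z) = measure (expo 0) Y * measure (after_jump 0) Z"
    if "Y \<in> sets borel" "Z \<in> sets seqM" for Y Z
    using that by (simp add: measure_def A.emeasure_pair_measure_Times enn2real_mult)
  have expo_gt: "measure (expo 0) {a<..} = exp (- exit_rate Q 0 * max 0 a)" for a
    using emeasure_expo[OF zero_in_S, of a] by (simp add: measure_def)
  have "measure (expo 0) ({0<..} - {1 - u<..}) = c"
    using u by (subst E.finite_measure_Diff) (auto simp: expo_gt c_def)
  moreover have "{0<..} - {1 - u<..} = {0<..1 - u}" by auto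
  ultimately have m1: "measure (expo 0) {0<..1 - u} = c" by simp
  \<comment> \<open>The exponential law has no mass at h \<le> 0, so this half-line weighs as much
    as the bounded interval above, and covering \<open>B'\<close> by it needs no lower bound on
    h.\<close>
  have "measure (expo 0) (space (expo 0) - {1 - u<..}) = c"
    using u by (subst E.prob_compl) (auto simp: expo_gt c_def)
  moreover have "space (expo 0) - {1 - u<..} = {..1 - u}" by auto
  ultimately have m2: "measure (expo 0) {..1 - u} = c" by simp
  have "c * tail_after_jump t = measure (expo 0 \<Otimes>\<^sub>M after_jump 0) ({0<..1 - u} \<times> {s. ereal t < ftau s})"
    by (simp add: rect sets_tail m1 tail_after_jump_def)
  also have "\<dots> \<le> measure (expo 0 \<Otimes>\<^sub>M after_jump 0) B'"
  proof (rule EA.P.finite_measure_mono[OF _ B'])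
    have "ereal t < ereal h + ftau s" if "0 < h" "ereal t < ftau s" for h s
      using that by (cases "ftau s") auto
    thus "{0<..1 - u} \<times> {s. ereal t < ftau s} \<subseteq> B'" by (auto simp: B'_def)
  qed
  finally show "c * tail_after_jump t \<le> surv P X (AtZero u) t" by (simp add: surv)
  have "measure (expo 0 \<Otimes>\<^sub>M after_jump 0) B' \<le>
      measure (expo 0 \<Otimes>\<^sub>M after_jump 0) ({..1 - u} \<times> {s. ereal (t - (1 - u)) < ftau s})"
  proof (rule EA.P.finite_measure_mono)
    have "ereal (t - (1 - u)) < ftau s" if "h \<le> 1 - u" "ereal t < ereal h + ftau s" for h s
      using that by (cases "ftau s") auto
    thus "B' \<subseteq> {..1 - u} \<times> {s. ereal (t - (1 - u)) < ftau s}" by (auto simp: B'_def)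
  qed (use sets_tail(1)[of "t - (1 - u)"] in auto)
  also have "\<dots> = c * tail_after_jump (t - (1 - u))" 
    by (simp add: rect sets_tail m2 tail_after_jump_def)
  finally show "surv P X (AtZero u) t \<le> c * tail_after_jump (t - (1 - u))" by (simp add: surv)
qed

lemma tail_after_jump_antimono: "t \<le> r \<Longrightarrow> tail_after_jump r \<le> tail_after_jump t"
proof -
  interpret A: prob_space "after_jump 0" by (rule prob_space_after_jump)
  assume "t \<le> r"
  thus "tail_after_jump r \<le> tail_after_jump t" unfolding tail_after_jump_def
    using sets_tail(1)[of t] by (intro A.finite_measure_mono) (auto intro: le_less_trans[of _ "ereal r"])
qed

lemma surv_0: "surv P X (AtZero 0) t = tail 0 t"
  using surv_hat[OF zero_in_S, of t] by (simp add: hat_def tail_def)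

section \<open>An exponential moment for the time to hit 0\<close>

text \<open>If the killed chain is in state j at time t, then the jump interval containing t ends a
  passage to j that has avoided 0; some number of jumps must have positive probability.\<close>

lemma ex_first_passage:
  assumes k: "k \<in> S - {0}" and j: "j \<in> S - {0}" and killed: "killed_irreducible (S - {0}) P X"
  shows "\<exists>n. 0 < emeasure (seq_law k) (reach n (- {0}) j)"
proof (rule ex_pos_seq_law[OF _ _ sets_reach])
  show "k \<in> S" using k by simp
  show "0 < measure (P k) {w \<in> space (P k). \<exists>t\<ge>0. killed (traj w) t = Some j}"
    using killed k j by (simp add: killed_irreducible_def)
  fix w assume "w \<in> {w \<in> space (P k). \<exists>t\<ge>0. killed (traj w) t = Some j}" and w: "good_path (traj w)"
  then obtain t where t: "0 \<le> t" "X t w = j" "ereal t < tau0 (traj w)"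
    by (auto simp: killed_def split: if_splits)
  obtain n where n: "tsum (jseq (traj w)) n \<le> t" "t < tsum (jseq (traj w)) (Suc n)"
    using ex_jump_interval[OF w t(1)] .
  have "fst (jseq (traj w) m) \<noteq> 0" if "m < n" for m
  proof
    assume "fst (jseq (traj w) m) = 0"
    hence "tau0 (traj w) \<le> ereal (tsum (jseq (traj w)) m)"
      unfolding tau0_def using tsum_jseq_nonneg[OF w, of m]
      by (intro Inf_lower) (auto simp: fst_jseq[OF w])
    also have "\<dots> \<le> ereal t" using tsum_jseq_mono[OF w, of m n] that n by simp
    finally show False using t by simp
  qed
  thus "\<exists>n. jseq (traj w) \<in> reach n (- {0}) j"
    using path_between_jumps[OF w n] t by (intro exI[of _ n]) (auto simp: reach_def)
qed

text \<open>On a passage from k to j that avoids 0, the hitting time is the time of the passage plus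
  a fresh hitting time from j, and dropping the former only lowers the tail. The factor is
  independent of t, so integrability against exp (l * t) passes from k to j.\<close>

lemma tau0_tail_comparison:
  assumes k: "k \<in> S" and j: "j \<in> S"
  shows "emeasure (seq_law k) (reach n (- {0}) j) * emeasure (seq_law j) {s. ereal t < ftau0 s} \<le>
    emeasure (seq_law k) {s. ereal t < ftau0 s}"
proof -
  define g :: "real \<times> (nat \<Rightarrow> nat \<times> real) \<Rightarrow> ennreal" where
    "g p = indicator {e. ereal t < e} (ereal (fst p) + ftau0 (snd p))" for p
  have g: "g \<in> borel_measurable (borel \<Otimes>\<^sub>M seqM)"
  proof -
    have "(\<lambda>p. ereal (fst p) + ftau0 (snd p)) \<in> borel_measurable (borel \<Otimes>\<^sub>M seqM)"
      by (intro borel_measurable_ereal_add borel_measurable_ereal measurable_fst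
        measurable_compose[OF measurable_snd measurable_ftau0])
    thus ?thesis unfolding g_def[abs_def]
      by (rule measurable_compose[OF _ borel_measurable_indicator]) (simp flip: greaterThan_def)
  qed
  let ?R = "reach n (- {0}) j" and ?A = "{s. ereal t < ftau0 s}"
  have "emeasure (seq_law k) ?R * emeasure (seq_law j) ?A = (\<integral>\<^sup>+s. indicator ?R s * emeasure (seq_law j) ?A \<partial>seq_law k)"
    using sets_reach by (simp add: nn_integral_multc)
  also have "\<dots> \<le> (\<integral>\<^sup>+s. indicator ?R s * (\<integral>\<^sup>+s'. g (tsum s n, s') \<partial>seq_law j) \<partial>seq_law k)"
  proof (rule nn_integral_mono_AE)
    show "AE s in seq_law k. indicator ?R s * emeasure (seq_law j) ?A \<le> indicator ?R s * (\<integral>\<^sup>+s'. g (tsum s n, s') \<partial>seq_law j)"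
      using seq_law_AE[OF k]
    proof eventually_elim
      case (elim s)
      have "0 \<le> tsum s n" unfolding tsum_def by (rule sum_nonneg) (use elim in \<open>simp add: less_imp_le\<close>)
      hence "indicator ?A s' \<le> g (tsum s n, s')" for s'
        by (cases "ftau0 s'") (auto simp: g_def indicator_def)
      hence "(\<integral>\<^sup>+s'. indicator ?A s' \<partial>seq_law j) \<le> (\<integral>\<^sup>+s'. g (tsum s n, s') \<partial>seq_law j)"
        by (intro nn_integral_mono)
      thus ?case using sets_tail(2)[of t] by (intro mult_left_mono) auto
    qed
  qed
  also have "\<dots> = (\<integral>\<^sup>+s. indicator ?R s * g (tsum s n, \<lambda>k. s (n + k)) \<partial>seq_law k)"
    by (rule markov[OF j k g, symmetric])
  also have "\<dots> \<le> (\<integral>\<^sup>+s. indicator ?A s \<partial>seq_law k)"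
  proof (rule nn_integral_mono)
    fix s show "indicator ?R s * g (tsum s n, \<lambda>k. s (n + k)) \<le> indicator ?A s"
      using ftau0_shift[of n s] by (auto simp: indicator_def g_def reach_def)
  qed
  also have "\<dots> = emeasure (seq_law k) ?A" using sets_tail(2)[of t] by simp
  finally show ?thesis .
qed

text \<open>Keeping only the last unit of the interval bounds the integral below by exp (l * (y -
  1)), without evaluating it; the summand 1 covers y \<le> 1.\<close>

lemma exp_integral_ge:
  assumes "0 < l" "0 \<le> y"
  shows "ennreal (exp (l * y)) \<le> ennreal (exp l) * (1 + (\<integral>\<^sup>+t. indicator {0..<y} t * ennreal (exp (l * t)) \<partial>lborel))"
proof (cases "y \<le> 1")
  case True
  have "ennreal (exp (l * y)) \<le> ennreal (exp l) * 1" using assms True by (simp add: ennreal_leI)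
  also have "\<dots> \<le> ennreal (exp l) * (1 + (\<integral>\<^sup>+t. indicator {0..<y} t * ennreal (exp (l * t)) \<partial>lborel))"
    by (intro mult_left_mono) auto
  finally show ?thesis .
next
  case False
  have "ennreal (exp (l * (y - 1))) = (\<integral>\<^sup>+t. ennreal (exp (l * (y - 1))) * indicator {y - 1..<y} t \<partial>lborel)"
    by (subst nn_integral_cmult_indicator) auto
  also have "\<dots> \<le> (\<integral>\<^sup>+t. indicator {0..<y} t * ennreal (exp (l * t)) \<partial>lborel)"
    using assms False by (intro nn_integral_mono) (auto simp: indicator_def intro!: ennreal_leI)
  finally have "ennreal (exp l) * ennreal (exp (l * (y - 1))) \<le>
      ennreal (exp l) * (1 + (\<integral>\<^sup>+t. indicator {0..<y} t * ennreal (exp (l * t)) \<partial>lborel))"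
    by (intro mult_left_mono) (auto intro: order_trans)
  moreover have "ennreal (exp l) * ennreal (exp (l * (y - 1))) = ennreal (exp (l * y))"
    by (simp add: ennreal_mult[symmetric] exp_add[symmetric] algebra_simps)
  ultimately show ?thesis by simp
qed

text \<open>For l strictly between 0 and mu^C the integral in \<open>mu_C\<close> is finite. After
  the comparison of tails, Fubini turns the integral of the tail from j into the mean of the
  integral of exp (l * t) up to the hitting time, which controls the moment.\<close>

lemma exponential_moment:
  assumes k: "k \<in> S - {0}" and j: "j \<in> S - {0}" and killed: "killed_irreducible (S - {0}) P X"
    and mu: "0 < mu_C P X k"
  obtains l where "0 < l" "integrable (seq_law j) (\<lambda>s. exp (l * hit0 s))"
proof -
  have kS: "k \<in> S" and jS: "j \<in> S" using k j by auto
  interpret J: prob_space "seq_law j" by (rule prob_space_seq_law)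
  obtain l where l: "0 < ereal l" "ereal l < mu_C P X k" using ereal_dense2[OF mu] by blast
  let ?b = "\<lambda>i t. emeasure (seq_law i) {s. ereal t < ftau0 s}"
  have b_meas: "measure (P k) {w \<in> space (P k). ereal t < tau0 (traj w)} = measure (seq_law k) {s. ereal t < ftau0 s}" for t
    by (rule tau0_tail[OF kS])
  have "(\<integral>\<^sup>+t\<in>{0..}. ennreal (measure (P k) {w \<in> space (P k). ereal t < tau0 (traj w)} * exp (l * t)) \<partial>lborel) \<noteq> \<infinity>"
  proof
    assume "(\<integral>\<^sup>+t\<in>{0..}. ennreal (measure (P k) {w \<in> space (P k). ereal t < tau0 (traj w)} * exp (l * t)) \<partial>lborel) = \<infinity>"
    hence "mu_C P X k \<le> ereal l" unfolding mu_C_def by (intro Inf_lower) auto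
    thus False using l by simp
  qed
  hence fin_k: "(\<integral>\<^sup>+t. ?b k t * (ennreal (exp (l * t)) * indicator {0..} t) \<partial>lborel) < \<infinity>"
    using prob_space.finite_measure[OF prob_space_seq_law, THEN finite_measure.emeasure_eq_measure]
    by (simp add: b_meas ennreal_mult' less_top mult.assoc)
  obtain n where p: "0 < emeasure (seq_law k) (reach n (- {0}) j)" using ex_first_passage[OF k j killed] by blast
  let ?p = "emeasure (seq_law k) (reach n (- {0}) j)"
  have b_j: "(\<lambda>(t, s). indicator {0..<hit0 s} t * ennreal (exp (l * t))) \<in> borel_measurable (lborel \<Otimes>\<^sub>M seq_law j)"
  proof -
    have h: "(\<lambda>p. hit0 (snd p)) \<in> borel_measurable (borel \<Otimes>\<^sub>M seqM)"
      by (rule measurable_compose[OF measurable_snd measurable_hit0])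
    note h[measurable]
    \<comment> \<open>The indicator of an interval with random end is rewritten as a condition on
      the pair (t, s), whose joint measurability is immediate.\<close>
    have m: "(\<lambda>p. (if 0 \<le> fst p \<and> fst p < hit0 (snd p) then 1 else 0) * ennreal (exp (l * fst p))) \<in> borel_measurable (borel \<Otimes>\<^sub>M seqM)"
      by measurable
    have eq: "(\<lambda>(t, s). indicator {0..<hit0 s} t * ennreal (exp (l * t))) =
        (\<lambda>p. (if 0 \<le> fst p \<and> fst p < hit0 (snd p) then 1 else 0) * ennreal (exp (l * fst p)))"
      by (auto simp: fun_eq_iff indicator_def)
    have sets: "sets (lborel \<Otimes>\<^sub>M seq_law j) = sets (borel \<Otimes>\<^sub>M seqM)"
      by (rule sets_pair_measure_cong) auto
    show ?thesis unfolding eq measurable_cong_sets[OF sets refl] by (rule m)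
  qed
  interpret LJ: pair_sigma_finite lborel "seq_law j" ..
  have "(\<integral>\<^sup>+s. \<integral>\<^sup>+t. indicator {0..<hit0 s} t * ennreal (exp (l * t)) \<partial>lborel \<partial>seq_law j) =
      (\<integral>\<^sup>+t. \<integral>\<^sup>+s. indicator {0..<hit0 s} t * ennreal (exp (l * t)) \<partial>seq_law j \<partial>lborel)"
    using LJ.Fubini[OF b_j] by simp
  also have "\<dots> = (\<integral>\<^sup>+t. ?b j t * (ennreal (exp (l * t)) * indicator {0..} t) \<partial>lborel)"
  proof (rule nn_integral_cong)
    fix t
    have "(\<integral>\<^sup>+s. indicator {0..<hit0 s} t * ennreal (exp (l * t)) \<partial>seq_law j) =
        (\<integral>\<^sup>+s. indicator {s. ereal t < ftau0 s} s * (ennreal (exp (l * t)) * indicator {0..} t) \<partial>seq_law j)"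
    proof (rule nn_integral_cong_AE)
      show "AE s in seq_law j. indicator {0..<hit0 s} t * ennreal (exp (l * t)) =
          indicator {s. ereal t < ftau0 s} s * (ennreal (exp (l * t)) * indicator {0..} t)"
        using hit0_AE[OF jS] by eventually_elim (auto simp: indicator_def)
    qed
    also have "\<dots> = ?b j t * (ennreal (exp (l * t)) * indicator {0..} t)"
      using sets_tail(2)[of t] by (simp add: nn_integral_multc)
    finally show "(\<integral>\<^sup>+s. indicator {0..<hit0 s} t * ennreal (exp (l * t)) \<partial>seq_law j) =
      ?b j t * (ennreal (exp (l * t)) * indicator {0..} t)" .
  qed
  finally have fubini: "(\<integral>\<^sup>+s. \<integral>\<^sup>+t. indicator {0..<hit0 s} t * ennreal (exp (l * t)) \<partial>lborel \<partial>seq_law j) =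
    (\<integral>\<^sup>+t. ?b j t * (ennreal (exp (l * t)) * indicator {0..} t) \<partial>lborel)" .
  have meas_j: "(\<lambda>t. ?b j t * (ennreal (exp (l * t)) * indicator {0..} t)) \<in> borel_measurable lborel"
  proof -
    have "(\<lambda>t. - measure (seq_law j) {s. ereal t < ftau0 s}) \<in> borel_measurable borel"
    proof (rule borel_measurable_mono, rule monoI)
      fix t r :: real assume "t \<le> r"
      thus "- measure (seq_law j) {s. ereal t < ftau0 s} \<le> - measure (seq_law j) {s. ereal r < ftau0 s}"
        using sets_tail(2)[of t] by (simp, intro J.finite_measure_mono) (auto intro: le_less_trans[of _ "ereal r"])
    qed
    hence "(\<lambda>t. - (- measure (seq_law j) {s. ereal t < ftau0 s})) \<in> borel_measurable borel"
      by (rule borel_measurable_uminus)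
    hence [measurable]: "(\<lambda>t. measure (seq_law j) {s. ereal t < ftau0 s}) \<in> borel_measurable borel" by simp
    show ?thesis unfolding J.emeasure_eq_measure by measurable
  qed
  have "?p * (\<integral>\<^sup>+t. ?b j t * (ennreal (exp (l * t)) * indicator {0..} t) \<partial>lborel) =
      (\<integral>\<^sup>+t. ?p * ?b j t * (ennreal (exp (l * t)) * indicator {0..} t) \<partial>lborel)"
    using meas_j by (simp add: nn_integral_cmult mult.assoc)
  also have "\<dots> \<le> (\<integral>\<^sup>+t. ?b k t * (ennreal (exp (l * t)) * indicator {0..} t) \<partial>lborel)"
    by (intro nn_integral_mono mult_right_mono tau0_tail_comparison[OF kS jS]) simp
  also note fin_k
  finally have "(\<integral>\<^sup>+t. ?b j t * (ennreal (exp (l * t)) * indicator {0..} t) \<partial>lborel) < \<infinity>"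
    using p by (auto simp: ennreal_mult_less_top less_top[symmetric])
  note fin_j = this[folded fubini]
  have "(\<integral>\<^sup>+s. ennreal (exp (l * hit0 s)) \<partial>seq_law j) \<le>
     (\<integral>\<^sup>+s. ennreal (exp l) * (1 + (\<integral>\<^sup>+t. indicator {0..<hit0 s} t * ennreal (exp (l * t)) \<partial>lborel)) \<partial>seq_law j)"
  proof (rule nn_integral_mono_AE)
    show "AE s in seq_law j. ennreal (exp (l * hit0 s)) \<le>
      ennreal (exp l) * (1 + (\<integral>\<^sup>+t. indicator {0..<hit0 s} t * ennreal (exp (l * t)) \<partial>lborel))"
      using hit0_AE[OF jS] by eventually_elim (rule exp_integral_ge, use l in auto)
  qed
  also have "\<dots> = ennreal (exp l) * (1 + (\<integral>\<^sup>+s. \<integral>\<^sup>+t. indicator {0..<hit0 s} t * ennreal (exp (l * t)) \<partial>lborel \<partial>seq_law j))"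
  proof -
    have "(\<lambda>s. \<integral>\<^sup>+t. indicator {0..<hit0 s} t * ennreal (exp (l * t)) \<partial>lborel) \<in> borel_measurable (seq_law j)"
      using lborel.borel_measurable_nn_integral_fst[OF measurable_pair_swap[OF b_j]] by simp
    thus ?thesis by (simp add: nn_integral_cmult nn_integral_add J.emeasure_space_1[simplified])
  qed
  also have "\<dots> < \<infinity>" using fin_j by (auto simp: ennreal_mult_less_top)
  finally have "(\<integral>\<^sup>+s. ennreal (exp (l * hit0 s)) \<partial>seq_law j) < \<infinity>" .
  moreover have "(\<lambda>s. exp (l * hit0 s)) \<in> borel_measurable (seq_law j)"
    using measurable_hit0 by (simp add: measurable_cong_sets[OF sets_seq_law refl])
  ultimately have "integrable (seq_law j) (\<lambda>s. exp (l * hit0 s))"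
    by (intro integrableI_nonneg) auto
  thus ?thesis using l by (intro that[of l]) auto
qed

end

section \<open>Proof of the theorem\<close>

context recurrent_ctmc
begin

text \<open>
  On \<open>\<tau> = \<infinity>\<close> the real-valued version of \<open>\<tau>\<close> is 0. Instead of showing that this event is null, its
  probability is carried along: adding a constant to a tail keeps it long.
\<close>

lemma tail_0_split:
  defines "Z \<equiv> \<lambda>w. real_of_ereal (tau 0 (traj w))"
  assumes t: "0 \<le> t"
  shows "tail 0 t = measure (P 0) {w \<in> space (P 0). tau 0 (traj w) = \<infinity>} + (1 - cdf (distr (P 0) borel Z) t)"
proof -
  interpret prob_space "P 0" using prob_space_P[OF zero_in_S] .
  have tau [measurable]: "(\<lambda>w. tau 0 (traj w)) \<in> borel_measurable (P 0)"
    by (rule path_measurable(5)[OF zero_in_S]) simp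
  have Z [measurable]: "Z \<in> borel_measurable (P 0)" unfolding Z_def by measurable
  have "tail 0 t = prob {w \<in> space (P 0). ereal t < tau 0 (traj w)}"
    unfolding surv_0[symmetric] by (simp add: surv_def)
  also have "{w \<in> space (P 0). ereal t < tau 0 (traj w)} =
      {w \<in> space (P 0). tau 0 (traj w) = \<infinity>} \<union> {w \<in> space (P 0). t < Z w}"
  proof -
    have "ereal t < e \<longleftrightarrow> e = \<infinity> \<or> t < real_of_ereal e" for e using t by (cases e) auto
    thus ?thesis by (auto simp: Z_def)
  qed
  \<comment> \<open>The union is disjoint because \<open>Z\<close> is 0 where tau is infinite and t
    \<ge> 0.\<close>
  also have "prob \<dots> = prob {w \<in> space (P 0). tau 0 (traj w) = \<infinity>} + prob {w \<in> space (P 0). t < Z w}"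
    using t by (intro finite_measure_Union) (auto simp: Z_def)
  also have "prob {w \<in> space (P 0). t < Z w} = 1 - prob (Z -` {..t} \<inter> space (P 0))"
  proof -
    have "{w \<in> space (P 0). t < Z w} = space (P 0) - (Z -` {..t} \<inter> space (P 0))" by auto
    thus ?thesis using prob_compl[of "Z -` {..t} \<inter> space (P 0)"] by simp
  qed
  also have "prob (Z -` {..t} \<inter> space (P 0)) = cdf (distr (P 0) borel Z) t"
    by (simp add: cdf_def measure_distr)
  finally show ?thesis .
qed

lemma tail_0_long:
  assumes sub: "subexponential (P 0) (\<lambda>w. real_of_ereal (tau 0 (traj w)))"
  shows "0 < tail 0 t" and "0 \<le> v \<Longrightarrow> ((\<lambda>t. tail 0 (t - v) / tail 0 t) \<longlongrightarrow> 1) at_top"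
proof -
  define F where "F t = 1 - cdf (distr (P 0) borel (\<lambda>w. real_of_ereal (tau 0 (traj w)))) t" for t
  define p where "p = measure (P 0) {w \<in> space (P 0). tau 0 (traj w) = \<infinity>}"
  have F: "0 < F t" "0 \<le> v \<Longrightarrow> ((\<lambda>t. F (t - v) / F t) \<longlongrightarrow> 1) at_top" for t v
    using subexponential_long_tailed[OF prob_space_P[OF zero_in_S] sub] by (simp_all add: F_def)
  have p: "0 \<le> p" by (simp add: p_def)
  have tail: "tail 0 t = p + F t" if "0 \<le> t" for t
    using tail_0_split[OF that] by (simp add: p_def F_def)
  show pos: "0 < tail 0 t" for t
  proof -
    have "0 < tail 0 (max 0 t)" using tail[of "max 0 t"] F(1)[of "max 0 t"] p by simp
    also have "\<dots> \<le> tail 0 t" by (rule antimonoD[OF tail_antimono]) simp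
    finally show ?thesis .
  qed
  show "((\<lambda>t. tail 0 (t - v) / tail 0 t) \<longlongrightarrow> 1) at_top" if v: "0 \<le> v"
  proof (rule tendsto_sandwich)
    have anti: "tail 0 t \<le> tail 0 (t - v)" for t by (rule antimonoD[OF tail_antimono]) (use v in simp)
    show "\<forall>\<^sub>F t in at_top. 1 \<le> tail 0 (t - v) / tail 0 t"
      using pos anti by (intro always_eventually allI) (simp add: le_divide_eq)
    show "\<forall>\<^sub>F t in at_top. tail 0 (t - v) / tail 0 t \<le> F (t - v) / F t"
      using eventually_ge_at_top[of v]
    proof eventually_elim
      case (elim t)
      have t: "tail 0 t = p + F t" "tail 0 (t - v) = p + F (t - v)" using tail elim v by auto
      \<comment> \<open>After clearing denominators, this is exactly the claim that adding p to
        numerator and denominator brings a ratio above 1 closer to 1.\<close>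
      hence "p * F t \<le> p * F (t - v)" using anti[of t] p by (intro mult_left_mono) auto
      thus ?case using F(1)[of t] p pos[of t] by (simp add: t divide_simps algebra_simps)
    qed
  qed (use F(2)[OF v] in auto)
qed

lemma tail_ratio:
  assumes sub: "subexponential (P 0) (\<lambda>w. real_of_ereal (tau 0 (traj w)))"
    and killed: "killed_irreducible (S - {0}) P X"
    and k: "k \<in> S - {0}" and mu: "0 < mu_C P X k" and j: "j \<in> S"
  shows "((\<lambda>t. tail j t / tail 0 t) \<longlongrightarrow> 1) at_top"
proof (cases "j = 0")
  case True
  have "tail 0 t \<noteq> 0" for t using tail_0_long(1)[OF sub, of t] by simp
  thus ?thesis using True by simp
next
  case False
  hence j': "j \<in> S - {0}" using j by simp
  obtain l where l: "0 < l" "integrable (seq_law j) (\<lambda>s. exp (l * hit0 s))"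
    using exponential_moment[OF k j' killed mu] .
  have "((\<lambda>t. (LINT s|seq_law j. tail 0 (t - hit0 s)) / tail 0 t) \<longlongrightarrow> 1) at_top"
  proof (rule long_tailed_light_convolution[OF tail_antimono tail_0_long(1)[OF sub] tail_le_1 tail_0_long(2)[OF sub]
        prob_space_seq_law _ _ l(2,1)])
    show "hit0 \<in> borel_measurable (seq_law j)"
      using measurable_hit0 by (simp add: measurable_cong_sets[OF sets_seq_law refl])
    show "AE s in seq_law j. 0 \<le> hit0 s" using hit0_AE[OF j] by eventually_elim simp
  qed
  thus ?thesis by (simp only: tail_decomposition[OF j, symmetric])
qed

lemma filterlim_minus_const_at_top: "filterlim (\<lambda>t::real. t - v) at_top at_top"
  using filterlim_tendsto_add_at_top[OF tendsto_const[of "- v"] filterlim_ident] by simp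

lemma surv_hat_ratio:
  assumes sub: "subexponential (P 0) (\<lambda>w. real_of_ereal (tau 0 (traj w)))"
    and killed: "killed_irreducible (S - {0}) P X"
    and k: "k \<in> S - {0}" and mu: "0 < mu_C P X k" and "i \<in> S" "j \<in> S" and v: "0 \<le> v"
  shows "((\<lambda>t. surv P X (hat i) (t - v) / surv P X (hat j) t) \<longlongrightarrow> 1) at_top"
proof -
  note ratio = tail_ratio[OF sub killed k mu]
  have pos: "tail 0 t \<noteq> 0" for t using tail_0_long(1)[OF sub, of t] by simp
  have "((\<lambda>t. tail i (t - v) / tail 0 (t - v) * (tail 0 (t - v) / tail 0 t) / (tail j t / tail 0 t)) \<longlongrightarrow> 1 * 1 / 1) at_top"
    by (intro tendsto_divide tendsto_mult ratio tail_0_long(2)[OF sub v] assms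
      filterlim_compose[OF ratio filterlim_minus_const_at_top]) auto
  moreover have "tail i (t - v) / tail 0 (t - v) * (tail 0 (t - v) / tail 0 t) / (tail j t / tail 0 t) =
      surv P X (hat i) (t - v) / surv P X (hat j) t" for t
    using pos[of t] pos[of "t - v"] assms by (simp add: surv_hat tail_def)
  ultimately show ?thesis by simp
qed

lemma surv_AtZero_ratio:
  assumes sub: "subexponential (P 0) (\<lambda>w. real_of_ereal (tau 0 (traj w)))"
    and v: "0 \<le> v" and u: "0 \<le> u" "u < 1"
  shows "((\<lambda>t. surv P X (AtZero u) (t - v) / surv P X (AtZero 0) t) \<longlongrightarrow>
     (1 - exp (- exit_rate Q 0 * (1 - u))) / (1 - exp (- exit_rate Q 0))) at_top"
proof -
  define c where "c u = 1 - exp (- exit_rate Q 0 * (1 - u))" for u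
  have q: "0 < exit_rate Q 0" by (rule exit_rate_pos[OF zero_in_S])
  have c: "0 < c u" if "u < 1" for u using that q by (simp add: c_def)
  have pos: "0 < tail 0 t" for t by (rule tail_0_long(1)[OF sub])
  \<comment> \<open>The bounds for u = 0 are read backwards here: they enclose G between F (t + 1) /
    c_0 and F t / c_0, and long-tailedness makes the shift harmless.\<close>
  have up: "tail_after_jump t \<le> tail 0 t / c 0" if "1 \<le> t" for t
    using surv_AtZero_bounds(1)[of 0 t] that c[of 0] by (simp add: surv_0 c_def le_divide_eq mult.commute)
  have lo: "tail 0 (t + 1) / c 0 \<le> tail_after_jump t" if "0 \<le> t" for t
    using surv_AtZero_bounds(2)[of 0 "t + 1"] that c[of 0] by (simp add: surv_0 c_def divide_le_eq mult.commute)
  have "((\<lambda>t. surv P X (AtZero u) (t - v) / tail 0 t) \<longlongrightarrow> c u / c 0) at_top"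
  proof (rule tendsto_sandwich)
    show "\<forall>\<^sub>F t in at_top. c u / c 0 * (tail 0 (t + 1) / tail 0 t) \<le> surv P X (AtZero u) (t - v) / tail 0 t"
      using eventually_ge_at_top[of "v + 1"]
    proof eventually_elim
      case (elim t)
      have "c u * (tail 0 (t + 1) / c 0) \<le> c u * (tail 0 (t - v + 1) / c 0)"
        using c[of 0] c[OF u(2)] v by (intro mult_left_mono divide_right_mono antimonoD[OF tail_antimono]) auto
      also have "\<dots> \<le> c u * tail_after_jump (t - v)" using elim c[OF u(2)] by (intro mult_left_mono lo) auto
      also have "\<dots> \<le> surv P X (AtZero u) (t - v)"
        unfolding c_def by (rule surv_AtZero_bounds(1)) (use elim u in auto)
      finally have "c u * (tail 0 (t + 1) / c 0) / tail 0 t \<le> surv P X (AtZero u) (t - v) / tail 0 t"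
        using pos[of t] by (intro divide_right_mono) auto
      thus ?case by simp
    qed
    show "\<forall>\<^sub>F t in at_top. surv P X (AtZero u) (t - v) / tail 0 t \<le> c u / c 0 * (tail 0 (t - (v + 1)) / tail 0 t)"
      \<comment> \<open>The estimate \<open>up\<close> is applied at t - (v + 1), which must be at
        least 1.\<close>
      using eventually_ge_at_top[of "v + 2"]
    proof eventually_elim
      case (elim t)
      have "surv P X (AtZero u) (t - v) \<le> c u * tail_after_jump (t - v - (1 - u))"
        unfolding c_def by (rule surv_AtZero_bounds(2)) (use elim u in auto)
      also have "\<dots> \<le> c u * tail_after_jump (t - (v + 1))"
        using c[OF u(2)] u by (intro mult_left_mono tail_after_jump_antimono) auto
      also have "\<dots> \<le> c u * (tail 0 (t - (v + 1)) / c 0)"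
        using elim c[OF u(2)] by (intro mult_left_mono up) auto
      finally have "surv P X (AtZero u) (t - v) / tail 0 t \<le> c u * (tail 0 (t - (v + 1)) / c 0) / tail 0 t"
        using pos[of t] by (intro divide_right_mono) auto
      thus ?case by simp
    qed
    \<comment> \<open>A forward shift by 1 is the reciprocal of the backward shift taken at t +
      1.\<close>
    have "((\<lambda>t. inverse (tail 0 (t + 1 - 1) / tail 0 (t + 1))) \<longlongrightarrow> inverse 1) at_top"
      using filterlim_compose[OF tail_0_long(2)[OF sub, of 1] filterlim_minus_const_at_top[of "- 1"]]
      by (intro tendsto_inverse) auto
    hence "((\<lambda>t. tail 0 (t + 1) / tail 0 t) \<longlongrightarrow> 1) at_top" by simp
    from tendsto_mult[OF tendsto_const this, of "c u / c 0"]
    show "((\<lambda>t. c u / c 0 * (tail 0 (t + 1) / tail 0 t)) \<longlongrightarrow> c u / c 0) at_top" by simp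
    have "((\<lambda>t. tail 0 (t - (v + 1)) / tail 0 t) \<longlongrightarrow> 1) at_top"
      using v by (intro tail_0_long(2)[OF sub]) auto
    from tendsto_mult[OF tendsto_const this, of "c u / c 0"]
    show "((\<lambda>t. c u / c 0 * (tail 0 (t - (v + 1)) / tail 0 t)) \<longlongrightarrow> c u / c 0) at_top" by simp
  qed
  thus ?thesis by (simp add: c_def surv_0)
qed

end

theorem theorem3p6:
  fixes S :: "nat set" and Q :: "nat \<Rightarrow> nat \<Rightarrow> real"
    and P :: "nat \<Rightarrow> 'w measure" and X :: "real \<Rightarrow> 'w \<Rightarrow> nat" and k :: nat
  assumes S: "S = UNIV \<or> (\<exists>K\<ge>1. S = {0..K})"
    and chain: "ctmc S Q P X"
    and irreducible: "irreducible_chain S P X"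
    and non_explosive: "non_explosive S P X"
    and recurrent: "recurrent_chain S P X"
    and killed_irreducible: "killed_irreducible (S - {0}) P X"
    and k: "k \<in> S - {0}"
    and phi_zero: "0 = phi P X"
    and phi_less: "phi P X < mu_C P X k"
    and subexp: "subexponential (law P (AtZero 0)) (\<lambda>\<omega>. real_of_ereal (tau 0 (\<lambda>r. X r \<omega>)))"
  shows "(\<forall>v\<ge>0. \<forall>i\<in>S. \<forall>j\<in>S.
            ((\<lambda>t. surv P X (hat i) (t - v) / surv P X (hat j) t) \<longlongrightarrow> 1) at_top) \<and>
         (\<forall>v\<ge>0. \<forall>u\<in>{0..<1}.
            ((\<lambda>t. surv P X (AtZero u) (t - v) / surv P X (AtZero 0) t) \<longlongrightarrow>
               (1 - exp (- exit_rate Q 0 * (1 - u))) / (1 - exp (- exit_rate Q 0))) at_top)"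
proof -
  interpret recurrent_ctmc S Q P X
  proof (intro recurrent_ctmc.intro recurrent_ctmc_axioms.intro)
    show "0 \<in> S" using S by auto
    show "\<exists>i\<in>S. i \<noteq> 0" using k by blast
  qed (fact chain irreducible non_explosive recurrent)+
  have mu: "0 < mu_C P X k" using phi_zero phi_less by simp
  have sub: "subexponential (P 0) (\<lambda>\<omega>. real_of_ereal (tau 0 (\<lambda>r. X r \<omega>)))" using subexp by simp
  show ?thesis
    using surv_hat_ratio[OF sub killed_irreducible k mu] surv_AtZero_ratio[OF sub] by auto
qed

end
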